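(* Let $N\ge 1$ be an integer and let $P$ be a symmetric probability density on $\Lambda^N$ with $P>0$ a.e. If $N\ge 2$, suppose that for a.e. $x_N$ in some subset $B\subset\Lambda$ of positive $dx$ measure, there is a constant $\gamma(x_N)>0$ such that $$P(\cdot,x_N)\ge\gamma(x_N)P_{(N-1)}\quad\text{a.e. on }\Lambda^{N-1}.$$ Let $1\le m\le N$ be an integer and let $1\le r<\infty$. (i) If $u\in L^r(\Lambda^m;P_{(m)}d^mx)$, then $G_{m,N}(u)\in L^r(\Lambda^N;Pd^Nx)$ and $\|G_{m,N}(u)\|_{r,Pd^Nx}\le\|u\|_{r,P_{(m)}d^mx}$. (ii) Conversely, if $U\in L^r(\Lambda^N;Pd^Nx)$ is a generalized $N$-mean of order $m$, then $K_{m,N}(U)\in L^r(\Lambda^m;P_{(m)}d^mx)$ and there is a constant $C(m,N,P)$ independent of $U$ such that $\|K_{m,N}(U)\|_{r,P_{(m)}d^mx}\le C(m,N,P)\|U\|_{r,Pd^Nx}$.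
   Context: $\Lambda$ is a set with a $\sigma$-finite complete measure $dx$, of strictly positive total measure. For $k\ge 1$, $d^kx$ is the completion of the product measure $dx^{\otimes k}$ on $\Lambda^k$; "a.e.", "null set" and "measurable" on $\Lambda^k$ refer to $d^kx$. Functions are (extended) real-valued and defined a.e.; "a.e. finite" means finite-valued off a null set. No symmetry of $u$ or $U$ is assumed. For integers $1\le m\le N$ and an a.e. finite function $u$ on $\Lambda^m$, the generalized $N$-mean of order $m$ with kernel $u$ is the a.e. defined function on $\Lambda^N$ $$G_{m,N}(u)(x_1,\dots,x_N):=\binom{N}{m}^{-1}\sum_{1\le i_1<\cdots<i_m\le N}u(x_{i_1},\dots,x_{i_m}),$$ equality being understood a.e. on $\Lambda^N$. The kernel of a generalized $N$-mean of order $m$ is unique up to modification on a null set; $K_{m,N}$ denotes the inverse of $G_{m,N}$, i.e. $K_{m,N}(U)=u$ when $U=G_{m,N}(u)$. A probability density on $\Lambda^N$ is a function $P\in L^1(\Lambda^N;d^Nx)$ with $P\ge 0$ and $\int_{\Lambda^N}P\,d^Nx=1$. If $P$ is symmetric and $1\le k<N$, the $k$-variable reduction $P_{(k)}$ of $P$ is the (symmetric) probability density on $\Lambda^k$ obtained by integrating $P$ with respect to any $N-k$ of its variables; also $P_{(N)}:=P$. $\|\cdot\|_{r,\mu}$ denotes the norm of $L^r$ for the measure $\mu$. The function $\gamma$ is not assumed to be measurable. *)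

theory Defs
  imports "HOL-Analysis.Analysis" "HOL-Combinatorics.Permutations"
begin

text \<open>
  Points of \<open>\<Lambda>\<^sup>k\<close> are extensional functions on \<open>{1..k}\<close>. A general finite index set \<open>I\<close> is allowed so
  that integration over a subset of the variables is covered as well.

  Functions that are defined and finite almost everywhere are represented by total real-valued
  functions, and equalities between them are stated almost everywhere. No measurability is implied.
\<close>

definition power_measure :: "'a measure \<Rightarrow> nat set \<Rightarrow> (nat \<Rightarrow> 'a) measure" where
  "power_measure M I = completion (PiM I (\<lambda>_. M))"

definition increasing_indices :: "nat \<Rightarrow> nat \<Rightarrow> (nat \<Rightarrow> nat) set" where
  "increasing_indices m N = {i \<in> {1..m} \<rightarrow>\<^sub>E {1..N}. strict_mono_on {1..m} i}"

definition gen_mean :: "nat \<Rightarrow> nat \<Rightarrow> ((nat \<Rightarrow> 'a) \<Rightarrow> real) \<Rightarrow> (nat \<Rightarrow> 'a) \<Rightarrow> real" where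
  "gen_mean m N u x =
     (\<Sum>i\<in>increasing_indices m N. u (\<lambda>j\<in>{1..m}. x (i j))) / real (N choose m)"

text \<open>
  The kernel \<open>u\<close> is an arbitrary function, not assumed to be measurable.
\<close>

definition is_kernel_of ::
  "'a measure \<Rightarrow> nat \<Rightarrow> nat \<Rightarrow> ((nat \<Rightarrow> 'a) \<Rightarrow> real) \<Rightarrow> ((nat \<Rightarrow> 'a) \<Rightarrow> real) \<Rightarrow> bool" where
  "is_kernel_of M m N U u \<longleftrightarrow> (AE x in power_measure M {1..N}. U x = gen_mean m N u x)"

definition is_gen_mean :: "'a measure \<Rightarrow> nat \<Rightarrow> nat \<Rightarrow> ((nat \<Rightarrow> 'a) \<Rightarrow> real) \<Rightarrow> bool" where
  "is_gen_mean M m N U \<longleftrightarrow> (\<exists>u. is_kernel_of M m N U u)"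

text \<open>
  The inverse of \<^const>\<open>gen_mean\<close>. Kernels are unique only up to modification on a null set, so
  this picks an arbitrary representative. It is meaningful only if \<^term>\<open>is_gen_mean M m N U\<close>.
\<close>

definition gen_kernel ::
  "'a measure \<Rightarrow> nat \<Rightarrow> nat \<Rightarrow> ((nat \<Rightarrow> 'a) \<Rightarrow> real) \<Rightarrow> (nat \<Rightarrow> 'a) \<Rightarrow> real" where
  "gen_kernel M m N U = (SOME u. is_kernel_of M m N U u)"

definition prob_density_on :: "'a measure \<Rightarrow> nat \<Rightarrow> ((nat \<Rightarrow> 'a) \<Rightarrow> real) \<Rightarrow> bool" where
  "prob_density_on M N P \<longleftrightarrow>
     integrable (power_measure M {1..N}) P \<and>
     (AE x in power_measure M {1..N}. 0 \<le> P x) \<and>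
     (\<integral>x. P x \<partial>power_measure M {1..N}) = 1"

definition symmetric_on :: "'a measure \<Rightarrow> nat \<Rightarrow> ((nat \<Rightarrow> 'a) \<Rightarrow> real) \<Rightarrow> bool" where
  "symmetric_on M N P \<longleftrightarrow>
     (\<forall>\<pi>. \<pi> permutes {1..N} \<longrightarrow> (AE x in power_measure M {1..N}. P (x \<circ> \<pi>) = P x))"

text \<open>
  The \<open>k\<close>-variable reduction integrates out the last \<open>N - k\<close> variables; for symmetric \<open>P\<close> any other
  choice gives the same function almost everywhere.
\<close>

definition reduction ::
  "'a measure \<Rightarrow> nat \<Rightarrow> nat \<Rightarrow> ((nat \<Rightarrow> 'a) \<Rightarrow> real) \<Rightarrow> (nat \<Rightarrow> 'a) \<Rightarrow> real" where
  "reduction M N k P =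
     (if k = N then P
      else (\<lambda>x. \<integral>y. P (merge {1..k} {k+1..N} (x, y)) \<partial>power_measure M {k+1..N}))"

definition weighted_measure ::
  "'a measure \<Rightarrow> nat \<Rightarrow> ((nat \<Rightarrow> 'a) \<Rightarrow> real) \<Rightarrow> (nat \<Rightarrow> 'a) measure" where
  "weighted_measure M k p = density (power_measure M {1..k}) (\<lambda>x. ennreal (p x))"

definition in_Lr :: "real \<Rightarrow> 'b measure \<Rightarrow> ('b \<Rightarrow> real) \<Rightarrow> bool" where
  "in_Lr r \<mu> f \<longleftrightarrow> f \<in> borel_measurable \<mu> \<and> integrable \<mu> (\<lambda>x. \<bar>f x\<bar> powr r)"

definition norm_Lr :: "real \<Rightarrow> 'b measure \<Rightarrow> ('b \<Rightarrow> real) \<Rightarrow> real" where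
  "norm_Lr r \<mu> f = (\<integral>x. \<bar>f x\<bar> powr r \<partial>\<mu>) powr (1 / r)"

end

theory Submission
  imports Defs
begin

section \<open>Norm bounds for generalized means and their kernels\<close>

text \<open>
  Let \<open>S\<^sub>m\<^sub>,\<^sub>N u\<close> be the unnormalized mean and \<open>T\<^sub>N f (x) = \<Sum>\<^sub>j f (x\<^sub>1, ..., x\<^sub>j\<^sub>-\<^sub>1, x\<^sub>j\<^sub>+\<^sub>1, ..., x\<^sub>N\<^sub>+\<^sub>1)\<close>. Then
  \<open>T\<^sub>N (S\<^sub>m\<^sub>,\<^sub>N u) = (N + 1 - m) S\<^sub>m\<^sub>,\<^sub>N\<^sub>+\<^sub>1 u\<close>, and by convexity and symmetry \<open>T\<^sub>N / (N + 1)\<close> is a contraction;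
  iterating gives (i).

  For (ii), induct on \<open>m\<close> and then on \<open>N\<close>. With \<open>U = S\<^sub>m\<^sub>+\<^sub>1\<^sub>,\<^sub>N\<^sub>+\<^sub>1 u\<close> and \<open>v = u(\<cdot>, t)\<close>, the slice
  \<open>W = U(\<cdot>, t)\<close> equals \<open>S\<^sub>m\<^sub>+\<^sub>1\<^sub>,\<^sub>N u + S\<^sub>m\<^sub>,\<^sub>N v\<close>. By Markov's inequality and the lower bound on the slices of
  \<open>P\<close>, some \<open>t\<close> makes the norm of \<open>W\<close> at most a constant times that of \<open>U\<close>. Since
  \<open>T\<^sub>N W = (N - m) U + (N + 1 - m) S\<^sub>m\<^sub>,\<^sub>N\<^sub>+\<^sub>1 v\<close>, the mean \<open>S\<^sub>m\<^sub>,\<^sub>N\<^sub>+\<^sub>1 v\<close> is bounded, hence so are \<open>v\<close> by induction,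
  \<open>S\<^sub>m\<^sub>,\<^sub>N v\<close> by (i), \<open>S\<^sub>m\<^sub>+\<^sub>1\<^sub>,\<^sub>N u = W - S\<^sub>m\<^sub>,\<^sub>N v\<close>, and finally \<open>u\<close> by induction on \<open>N\<close>. The argument applies
  to any kernel, so measurability of the kernel comes out as a conclusion.
\<close>

text \<open>Otherwise the simplifier turns the index sets \<^term>\<open>{1..k::nat}\<close> into \<^term>\<open>{Suc 0..k}\<close>.\<close>

declare One_nat_def [simp del]

subsection \<open>Powers of a sigma-finite measure\<close>

locale power_space = sigma_finite_measure M for M :: "'a measure"
begin

sublocale product_sigma_finite "\<lambda>_::nat. M"
  by standard

abbreviation L :: "nat \<Rightarrow> (nat \<Rightarrow> 'a) measure" where
  "L k \<equiv> PiM {1..k} (\<lambda>_. M)"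

lemma insert_Suc: "insert (Suc k) {1..k} = {1..Suc k}"
  by auto

lemma measurable_upd [measurable]:
  "(\<lambda>(x, t). x(Suc k := t)) \<in> measurable (L k \<Otimes>\<^sub>M M) (L (Suc k))"
  using measurable_add_dim[of "Suc k" "{1..k}" "\<lambda>_. M"] by (simp only: insert_Suc)

lemma upd_in_space: "x \<in> space (L k) \<Longrightarrow> t \<in> space M \<Longrightarrow> x(Suc k := t) \<in> space (L (Suc k))"
  by (auto simp: space_PiM PiE_iff extensional_def)

lemma measurable_slice:
  assumes [measurable]: "f \<in> measurable (L (Suc k)) R" and [measurable]: "t \<in> space M"
  shows "(\<lambda>x. f (x(Suc k := t))) \<in> measurable (L k) R"
proof -
  have "(\<lambda>x. f ((\<lambda>(x, t). x(Suc k := t)) (x, t))) \<in> measurable (L k) R"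
    by measurable
  then show ?thesis by simp
qed

lemma measurable_slice2:
  assumes [measurable]: "f \<in> measurable (L (Suc k)) R" and [measurable]: "x \<in> space (L k)"
  shows "(\<lambda>t. f (x(Suc k := t))) \<in> measurable M R"
proof -
  have "(\<lambda>t. f ((\<lambda>(x, t). x(Suc k := t)) (x, t))) \<in> measurable M R"
    by measurable
  then show ?thesis by simp
qed

lemma measurable_slice_pair:
  assumes [measurable]: "f \<in> measurable (L (Suc k)) R"
  shows "(\<lambda>(x, t). f (x(Suc k := t))) \<in> measurable (L k \<Otimes>\<^sub>M M) R"
  using measurable_comp[OF measurable_upd assms] by (simp add: comp_def case_prod_unfold)

lemma nn_integral_Suc:
  "f \<in> borel_measurable (L (Suc k)) \<Longrightarrow>
   (\<integral>\<^sup>+x. f x \<partial>L (Suc k)) = (\<integral>\<^sup>+x. (\<integral>\<^sup>+t. f (x(Suc k := t)) \<partial>M) \<partial>L k)"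
  using product_nn_integral_insert[of "{1..k}" "Suc k" f] by (simp add: insert_Suc del: insert_is_Un fun_upd_apply)

lemma nn_integral_Suc_rev:
  "f \<in> borel_measurable (L (Suc k)) \<Longrightarrow>
   (\<integral>\<^sup>+x. f x \<partial>L (Suc k)) = (\<integral>\<^sup>+t. (\<integral>\<^sup>+x. f (x(Suc k := t)) \<partial>L k) \<partial>M)"
  using product_nn_integral_insert_rev[of "{1..k}" "Suc k" f] by (simp add: insert_Suc)

lemma sigma_finite_L: "sigma_finite_measure (L k)"
  by (rule sigma_finite) simp

lemma measurable_integrate_out [measurable]:
  assumes "f \<in> borel_measurable (L (Suc k))"
  shows "(\<lambda>x. \<integral>\<^sup>+t. f (x(Suc k := t)) \<partial>M) \<in> borel_measurable (L k)"
  using borel_measurable_nn_integral[OF measurable_slice_pair[OF assms]] by simp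

lemma measurable_integrate_out_rev:
  assumes "f \<in> borel_measurable (L (Suc k))"
  shows "(\<lambda>t. \<integral>\<^sup>+x. f (x(Suc k := t)) \<partial>L k) \<in> borel_measurable M"
proof -
  interpret Lk: sigma_finite_measure "L k" by (rule sigma_finite_L)
  have "(\<lambda>(t, x). f (x(Suc k := t))) \<in> borel_measurable (M \<Otimes>\<^sub>M L k)"
    using measurable_comp[OF measurable_pair_swap' measurable_slice_pair[OF assms]]
    by (simp add: comp_def case_prod_unfold)
  from Lk.borel_measurable_nn_integral[OF this] show ?thesis by simp
qed

text \<open>Fubini for null sets. \<open>Q\<close> may be nonmeasurable, so its exceptional set is
  enclosed in a measurable null set \<open>A\<close>, almost all of whose sections are null.\<close>

lemma AE_Suc:
  assumes "AE z in L (Suc k). Q z"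
  shows "AE x in L k. AE t in M. Q (x(Suc k := t))"
proof -
  obtain A where A: "{z \<in> space (L (Suc k)). \<not> Q z} \<subseteq> A" "emeasure (L (Suc k)) A = 0"
    and [measurable]: "A \<in> sets (L (Suc k))"
    using AE_E[OF assms] by blast
  have "(\<integral>\<^sup>+x. (\<integral>\<^sup>+t. indicator A (x(Suc k := t)) \<partial>M) \<partial>L k) = 0"
    using A(2) by (subst nn_integral_Suc[symmetric]) (simp_all del: fun_upd_apply)
  then have "AE x in L k. (\<integral>\<^sup>+t. indicator A (x(Suc k := t)) \<partial>M) = 0"
    by (subst (asm) nn_integral_0_iff_AE) simp_all
  with AE_space show ?thesis
  proof eventually_elim
    case (elim x)
    then have x: "x \<in> space (L k)" and *: "(\<integral>\<^sup>+t. indicator A (x(Suc k := t)) \<partial>M) = 0" by simp_all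
    have [measurable]: "(\<lambda>t. indicator A (x(Suc k := t)) :: ennreal) \<in> borel_measurable M"
      by (rule measurable_slice2[OF _ x]) simp
    from * have "AE t in M. indicator A (x(Suc k := t)) = (0::ennreal)"
      by (subst (asm) nn_integral_0_iff_AE) simp_all
    with AE_space show ?case
    proof eventually_elim
      case (elim t)
      then show ?case
        using A(1) upd_in_space[of x k t] x by (auto simp: indicator_def split: if_splits)
    qed
  qed
qed

lemma AE_Suc_rev:
  assumes "AE z in L (Suc k). Q z"
  shows "AE t in M. AE x in L k. Q (x(Suc k := t))"
proof -
  obtain A where A: "{z \<in> space (L (Suc k)). \<not> Q z} \<subseteq> A" "emeasure (L (Suc k)) A = 0"
    and [measurable]: "A \<in> sets (L (Suc k))"
    using AE_E[OF assms] by blast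
  have "(\<integral>\<^sup>+t. (\<integral>\<^sup>+x. indicator A (x(Suc k := t)) \<partial>L k) \<partial>M) = 0"
    using A(2) by (subst nn_integral_Suc_rev[symmetric]) simp_all
  then have "AE t in M. (\<integral>\<^sup>+x. indicator A (x(Suc k := t)) \<partial>L k) = 0"
    by (subst (asm) nn_integral_0_iff_AE) (simp_all add: measurable_integrate_out_rev)
  with AE_space show ?thesis
  proof eventually_elim
    case (elim t)
    then have t: "t \<in> space M" and *: "(\<integral>\<^sup>+x. indicator A (x(Suc k := t)) \<partial>L k) = 0" by simp_all
    from * have "AE x in L k. indicator A (x(Suc k := t)) = (0::ennreal)"
      by (subst (asm) nn_integral_0_iff_AE) (simp_all add: measurable_slice[OF _ t])
    with AE_space show ?case
    proof eventually_elim
      case (elim x)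
      then show ?case
        using A(1) upd_in_space[of x k t] t by (auto simp: indicator_def split: if_splits)
    qed
  qed
qed

section \<open>Invariance under permutations of the coordinates\<close>

lemma measurable_perm:
  assumes "\<pi> permutes {1..k}"
  shows "(\<lambda>x. x \<circ> \<pi>) \<in> measurable (L k) (L k)"
proof (rule measurable_PiM_single')
  fix i assume "i \<in> {1..k}"
  then have "\<pi> i \<in> {1..k}" using permutes_in_image[OF assms] by blast
  then show "(\<lambda>x. (x \<circ> \<pi>) i) \<in> measurable (L k) M" by simp
next
  show "(\<lambda>x. x \<circ> \<pi>) \<in> space (L k) \<rightarrow> {1..k} \<rightarrow>\<^sub>E space M"
    using permutes_in_image[OF assms] permutes_not_in[OF assms]
    by (auto simp: space_PiM PiE_iff extensional_def)
qed

text \<open>Boxes determine the product measure. The preimage of a box is a box with reordered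
  sides, and the product of their measures stays the same.\<close>

lemma distr_perm:
  assumes p: "\<pi> permutes {1..k}"
  shows "distr (L k) (L k) (\<lambda>x. x \<circ> \<pi>) = L k"
proof (rule PiM_eqI)
  fix A assume A: "\<And>i. i \<in> {1..k} \<Longrightarrow> A i \<in> sets M"
  have inv: "inv \<pi> permutes {1..k}" by (rule permutes_inv[OF p])
  have vim: "(\<lambda>x. x \<circ> \<pi>) -` Pi\<^sub>E {1..k} A \<inter> space (L k) = Pi\<^sub>E {1..k} (\<lambda>i. A (inv \<pi> i))"
  proof (intro set_eqI iffI)
    fix x assume x: "x \<in> (\<lambda>x. x \<circ> \<pi>) -` Pi\<^sub>E {1..k} A \<inter> space (L k)"
    have "x i \<in> A (inv \<pi> i)" if i: "i \<in> {1..k}" for i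
    proof -
      have "inv \<pi> i \<in> {1..k}" using permutes_in_image[OF inv] i by blast
      then have "(x \<circ> \<pi>) (inv \<pi> i) \<in> A (inv \<pi> i)" using x by (blast dest: PiE_mem)
      then show ?thesis using permutes_inverses(1)[OF p] by simp
    qed
    then show "x \<in> Pi\<^sub>E {1..k} (\<lambda>i. A (inv \<pi> i))"
      using x by (auto simp: space_PiM PiE_iff)
  next
    fix x assume x: "x \<in> Pi\<^sub>E {1..k} (\<lambda>i. A (inv \<pi> i))"
    have "x (\<pi> i) \<in> A i" if i: "i \<in> {1..k}" for i
    proof -
      have "\<pi> i \<in> {1..k}" using permutes_in_image[OF p] i by blast
      then have "x (\<pi> i) \<in> A (inv \<pi> (\<pi> i))" using x by (blast dest: PiE_mem)
      then show ?thesis using permutes_inverses(2)[OF p] by simp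
    qed
    moreover have "x i \<in> space M" if i: "i \<in> {1..k}" for i
    proof -
      have "inv \<pi> i \<in> {1..k}" using permutes_in_image[OF inv] i by blast
      then show ?thesis using x i sets.sets_into_space[OF A] by (blast dest: PiE_mem)
    qed
    ultimately show "x \<in> (\<lambda>x. x \<circ> \<pi>) -` Pi\<^sub>E {1..k} A \<inter> space (L k)"
      using x permutes_not_in[OF p] by (auto simp: space_PiM PiE_iff extensional_def)
  qed
  have "emeasure (distr (L k) (L k) (\<lambda>x. x \<circ> \<pi>)) (Pi\<^sub>E {1..k} A)
      = emeasure (L k) (Pi\<^sub>E {1..k} (\<lambda>i. A (inv \<pi> i)))"
    using A by (subst emeasure_distr) (auto intro!: measurable_perm[OF p] sets_PiM_I_finite simp: vim)
  also have "\<dots> = (\<Prod>i\<in>{1..k}. emeasure M (A (inv \<pi> i)))"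
    using A permutes_in_image[OF inv] by (subst emeasure_PiM) auto
  also have "\<dots> = (\<Prod>i\<in>{1..k}. emeasure M (A i))"
    by (rule prod.permute[OF inv, unfolded comp_def, symmetric])
  finally show "emeasure (distr (L k) (L k) (\<lambda>x. x \<circ> \<pi>)) (Pi\<^sub>E {1..k} A)
      = (\<Prod>i\<in>{1..k}. emeasure M (A i))" .
qed simp_all

lemma AE_perm:
  assumes p: "\<pi> permutes {1..k}" and Q: "AE x in L k. Q x"
  shows "AE x in L k. Q (x \<circ> \<pi>)"
  by (rule AE_distrD[OF measurable_perm[OF p]]) (simp only: distr_perm[OF p] Q)

lemma nn_integral_perm:
  assumes p: "\<pi> permutes {1..k}" and f: "f \<in> borel_measurable (L k)"
  shows "(\<integral>\<^sup>+x. f (x \<circ> \<pi>) \<partial>L k) = (\<integral>\<^sup>+x. f x \<partial>L k)"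
  using nn_integral_distr[OF measurable_perm[OF p], of f] f by (simp add: distr_perm[OF p])

end

subsection \<open>Sums over increasing index tuples\<close>

text \<open>Deletion of coordinate \<open>j\<close> extended to a permutation: the deleted
  coordinate moves to the last place, so that invariance under permutations applies and only the
  last coordinate remains to be dropped.\<close>

definition skip :: "nat \<Rightarrow> nat \<Rightarrow> nat \<Rightarrow> nat" where
  "skip N j i = (if i \<in> {1..N} then if i < j then i else Suc i else if i = Suc N then j else i)"

lemma skip_permutes:
  assumes "j \<in> {1..Suc N}"
  shows "skip N j permutes {1..Suc N}"
proof (rule bij_imp_permutes)
  have "inj_on (skip N j) {1..Suc N}"
    using assms by (auto simp: inj_on_def skip_def split: if_splits)
  moreover have "skip N j ` {1..Suc N} \<subseteq> {1..Suc N}"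
    using assms by (auto simp: skip_def)
  ultimately show "bij_betw (skip N j) {1..Suc N} {1..Suc N}"
    by (simp add: bij_betw_def endo_inj_surj)
qed (auto simp: skip_def)

definition delete_coord :: "nat \<Rightarrow> nat \<Rightarrow> (nat \<Rightarrow> 'a) \<Rightarrow> nat \<Rightarrow> 'a" where
  "delete_coord N j x = restrict (x \<circ> skip N j) {1..N}"

text \<open>\<open>S\<close> of the overview, as \<open>deletion_sum\<close> is \<open>T\<close>.
  Without the binomial factor the recursion in \<open>N\<close> has no coefficients.\<close>

definition kernel_sum :: "nat \<Rightarrow> nat \<Rightarrow> ((nat \<Rightarrow> 'a) \<Rightarrow> real) \<Rightarrow> (nat \<Rightarrow> 'a) \<Rightarrow> real" where
  "kernel_sum m N u x = (\<Sum>i\<in>increasing_indices m N. u (\<lambda>j\<in>{1..m}. x (i j)))"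

definition deletion_sum :: "nat \<Rightarrow> ((nat \<Rightarrow> 'a) \<Rightarrow> real) \<Rightarrow> (nat \<Rightarrow> 'a) \<Rightarrow> real" where
  "deletion_sum N u x = (\<Sum>j\<in>{1..Suc N}. u (delete_coord N j x))"

lemma increasing_indices_0: "increasing_indices 0 N = {\<lambda>_. undefined}"
  by (auto simp: increasing_indices_def strict_mono_on_def)

lemma finite_increasing_indices: "finite (increasing_indices m N)"
  by (rule finite_subset[of _ "{1..m} \<rightarrow>\<^sub>E {1..N}"])
    (auto simp: increasing_indices_def intro: finite_PiE)

text \<open>Pascal's rule for tuples: a strictly increasing tuple attains \<open>Suc N\<close> in
  its last place or not at all.\<close>

lemma increasing_indices_Suc:
  "increasing_indices (Suc m) (Suc N)
     = increasing_indices (Suc m) N \<union> (\<lambda>i. i(Suc m := Suc N)) ` increasing_indices m N"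
  (is "?A = ?B \<union> ?C")
proof (intro set_eqI iffI)
  fix i assume i: "i \<in> ?A"
  have mono: "i a < i b" if "a \<in> {1..Suc m}" "b \<in> {1..Suc m}" "a < b" for a b
    using i that by (auto simp: increasing_indices_def strict_mono_on_def)
  have ran: "i a \<in> {1..Suc N}" if "a \<in> {1..Suc m}" for a
    using i that by (auto simp: increasing_indices_def)
  have ext: "i a = undefined" if "a \<notin> {1..Suc m}" for a
    using i that by (auto simp: increasing_indices_def PiE_iff extensional_def)
  show "i \<in> ?B \<union> ?C"
  proof (cases "i (Suc m) = Suc N")
    case True
    define i' where "i' = i(Suc m := undefined)"
    have "i' a \<in> {1..N}" if "a \<in> {1..m}" for a
      using mono[of a "Suc m"] ran[of a] that True by (auto simp: i'_def)
    then have "i' \<in> increasing_indices m N"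
      using mono ext by (auto simp: increasing_indices_def strict_mono_on_def i'_def PiE_iff extensional_def)
    moreover have "i = i'(Suc m := Suc N)"
      using True by (simp add: i'_def fun_upd_idem)
    ultimately show ?thesis by blast
  next
    case False
    have "i a \<in> {1..N}" if a: "a \<in> {1..Suc m}" for a
    proof -
      have "i (Suc m) \<le> N" using ran[of "Suc m"] False by auto
      then show ?thesis
        using mono[of a "Suc m"] ran[of a] a by (cases "a = Suc m") auto
    qed
    then have "i \<in> ?B"
      using mono ext by (auto simp: increasing_indices_def strict_mono_on_def PiE_iff extensional_def)
    then show ?thesis ..
  qed
next
  fix i assume "i \<in> ?B \<union> ?C"
  then show "i \<in> ?A"
  proof
    assume "i \<in> ?B"
    then show ?thesis by (fastforce simp: increasing_indices_def PiE_iff)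
  next
    assume "i \<in> ?C"
    then obtain i' where i': "i' \<in> increasing_indices m N" "i = i'(Suc m := Suc N)" by blast
    then have ran: "i' a \<in> {1..N}" if "a \<in> {1..m}" for a
      using that by (auto simp: increasing_indices_def)
    have "i a < i b" if "a \<in> {1..Suc m}" "b \<in> {1..Suc m}" "a < b" for a b
      using i' ran[of a] that by (auto simp: increasing_indices_def strict_mono_on_def)
    moreover have "i a \<in> {1..Suc N}" if "a \<in> {1..Suc m}" for a
      using i' ran[of a] that by auto
    ultimately show ?thesis
      using i' by (auto simp: increasing_indices_def strict_mono_on_def PiE_iff extensional_def)
  qed
qed

lemma increasing_indices_eq_empty: "N < m \<Longrightarrow> increasing_indices m N = {}"
proof (induction N arbitrary: m)
  case 0
  then have "{1..m} \<rightarrow>\<^sub>E {1..0::nat} = ({} :: (nat \<Rightarrow> nat) set)"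
    by (auto simp: PiE_eq_empty_iff intro!: exI[of _ 1])
  then show ?case by (auto simp: increasing_indices_def)
next
  case (Suc N)
  then obtain m' where "m = Suc m'" by (cases m) auto
  then show ?case using Suc by (simp add: increasing_indices_Suc)
qed

lemma kernel_sum_0: "kernel_sum 0 N u x = u (\<lambda>_. undefined)"
  by (simp add: kernel_sum_def increasing_indices_0)

lemma kernel_sum_eq_0: "N < m \<Longrightarrow> kernel_sum m N u x = 0"
  by (simp add: kernel_sum_def increasing_indices_eq_empty)

text \<open>Tuples that end in \<open>Suc N\<close> feed the last coordinate of \<open>x\<close>
  into the last slot of \<open>u\<close>, leaving a kernel of order \<open>m\<close> with one
  argument frozen.\<close>

lemma kernel_sum_Suc:
  "kernel_sum (Suc m) (Suc N) u x
     = kernel_sum (Suc m) N u x + kernel_sum m N (\<lambda>y. u (y(Suc m := x (Suc N)))) x"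
proof -
  have disj: "increasing_indices (Suc m) N \<inter> (\<lambda>i. i(Suc m := Suc N)) ` increasing_indices m N = {}"
  proof (rule ccontr)
    assume "\<not> ?thesis"
    then obtain i where "i \<in> increasing_indices (Suc m) N" "i (Suc m) = Suc N"
      by (metis (no_types, lifting) disjoint_iff fun_upd_same imageE)
    then have "Suc N \<in> {1..N}"
      by (metis (no_types, lifting) PiE_mem atLeastAtMost_iff increasing_indices_def le_add1
          mem_Collect_eq order_refl plus_1_eq_Suc)
    then show False by simp
  qed
  \<comment> \<open>Tuples are extensional, so the overwritten entry can be restored; hence
    injectivity.\<close>
  have undef: "i (Suc m) = undefined" if "i \<in> increasing_indices m N" for i
    using that by (auto simp: increasing_indices_def PiE_iff extensional_def)
  have inj: "inj_on (\<lambda>i. i(Suc m := Suc N)) (increasing_indices m N)"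
  proof (rule inj_onI)
    fix i i' assume *: "i \<in> increasing_indices m N" "i' \<in> increasing_indices m N"
      "i(Suc m := Suc N) = i'(Suc m := Suc N)"
    then have "i(Suc m := undefined) = i'(Suc m := undefined)"
      by (metis fun_upd_upd)
    then show "i = i'" using undef[OF *(1)] undef[OF *(2)] by (simp add: fun_upd_idem)
  qed
  have arg: "(\<lambda>j\<in>{1..Suc m}. x ((i(Suc m := Suc N)) j))
      = (\<lambda>j\<in>{1..m}. x (i j))(Suc m := x (Suc N))" for i
    by (auto simp: fun_eq_iff restrict_def)
  show ?thesis
    unfolding kernel_sum_def increasing_indices_Suc
    by (subst sum.union_disjoint[OF _ _ disj])
      (simp_all add: finite_increasing_indices sum.reindex[OF inj] arg del: fun_upd_apply)
qed

lemma kernel_sum_cong: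
  assumes "\<And>i. i \<in> {1..N} \<Longrightarrow> x i = y i"
  shows "kernel_sum m N u x = kernel_sum m N u y"
  unfolding kernel_sum_def
proof (rule sum.cong[OF refl])
  fix i assume "i \<in> increasing_indices m N"
  then have "i j \<in> {1..N}" if "j \<in> {1..m}" for j
    using that by (auto simp: increasing_indices_def)
  then have "(\<lambda>j\<in>{1..m}. x (i j)) = (\<lambda>j\<in>{1..m}. y (i j))"
    using assms by (intro restrict_ext) blast
  then show "u (\<lambda>j\<in>{1..m}. x (i j)) = u (\<lambda>j\<in>{1..m}. y (i j))" by simp
qed

lemma kernel_sum_eq_self: "kernel_sum m m u x = u (restrict x {1..m})"
proof (induction m arbitrary: u)
  case 0
  have "restrict x {1..0} = (\<lambda>_. undefined)" by (auto simp: restrict_def)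
  then show ?case by (simp add: kernel_sum_0)
next
  case (Suc m)
  have *: "(restrict x {1..m})(Suc m := x (Suc m)) = restrict x {1..Suc m}"
    by (auto simp: fun_eq_iff restrict_def)
  have "kernel_sum (Suc m) (Suc m) u x = u ((restrict x {1..m})(Suc m := x (Suc m)))"
    by (simp only: kernel_sum_Suc Suc.IH kernel_sum_eq_0 lessI add_0)
  then show ?case by (simp only: *)
qed

lemma kernel_sum_upd: "kernel_sum m N u (x(Suc N := t)) = kernel_sum m N u x"
  by (rule kernel_sum_cong) auto

text \<open>An index set of size \<open>m\<close> survives the deletion of \<open>j\<close> exactly
  when it avoids \<open>j\<close>, so each term occurs \<open>N + 1 - m\<close> times. Induction on
  \<open>N\<close>, splitting off the last variable, replaces the count. The subtraction is real;
  for \<open>m > N + 1\<close> both sides vanish.\<close>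

lemma deletion_sum_kernel_sum:
  "deletion_sum N (kernel_sum m N u) x = (1 + real N - real m) * kernel_sum m (Suc N) u x"
proof (induction N arbitrary: m u)
  case 0
  show ?case
  proof (cases m)
    case (Suc m')
    \<comment> \<open>For \<open>m = 1\<close> the factor is 0; for larger \<open>m\<close> the sum
      on the right is empty.\<close>
    then show ?thesis by (cases m') (auto simp: deletion_sum_def kernel_sum_eq_0)
  qed (simp add: deletion_sum_def kernel_sum_0)
next
  case (Suc N)
  show ?case
  proof (cases m)
    case 0
    then show ?thesis by (simp add: deletion_sum_def kernel_sum_0)
  next
    case m: (Suc m')
    define v where "v = (\<lambda>y. u (y(Suc m' := x (Suc (Suc N)))))"
    \<comment> \<open>Deleting the last coordinate contributes the term that raises the coefficient
      by one; every other deletion keeps that coordinate, so there the recursion applies with one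
      and the same \<open>v\<close>.\<close>
    have last: "kernel_sum m (Suc N) u (delete_coord (Suc N) (Suc (Suc N)) x) = kernel_sum m (Suc N) u x"
      by (rule kernel_sum_cong) (simp add: delete_coord_def skip_def)
    have *: "kernel_sum m (Suc N) u (delete_coord (Suc N) j x) = kernel_sum m N u (delete_coord N j x) + kernel_sum m' N v (delete_coord N j x)"
      if j: "j \<in> {1..Suc N}" for j
    proof -
      have "kernel_sum k N w (delete_coord (Suc N) j x) = kernel_sum k N w (delete_coord N j x)" for k w
        using j by (intro kernel_sum_cong) (auto simp: delete_coord_def skip_def)
      moreover have "delete_coord (Suc N) j x (Suc N) = x (Suc (Suc N))"
        using j by (auto simp: delete_coord_def skip_def)
      ultimately show ?thesis by (simp add: m kernel_sum_Suc v_def)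
    qed
    have "deletion_sum (Suc N) (kernel_sum m (Suc N) u) x
        = (\<Sum>j\<in>{1..Suc N}. kernel_sum m (Suc N) u (delete_coord (Suc N) j x)) + kernel_sum m (Suc N) u x"
      unfolding deletion_sum_def using last by simp
    also have "(\<Sum>j\<in>{1..Suc N}. kernel_sum m (Suc N) u (delete_coord (Suc N) j x))
        = deletion_sum N (kernel_sum m N u) x + deletion_sum N (kernel_sum m' N v) x"
      using * by (simp add: deletion_sum_def sum.distrib)
    also have "\<dots> = (1 + real N - real m) * kernel_sum m (Suc N) u x
        + (1 + real N - real m') * kernel_sum m' (Suc N) v x"
      by (simp only: Suc.IH)
    also have "\<dots> + kernel_sum m (Suc N) u x = (1 + real (Suc N) - real m) * kernel_sum m (Suc (Suc N)) u x"
      by (simp add: m v_def kernel_sum_Suc[of m' "Suc N"] algebra_simps)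
    finally show ?thesis .
  qed
qed

subsection \<open>Weighted integrals of powers\<close>

text \<open>The preimages under \<open>f\<close> and \<open>g\<close> differ by part of a null set,
  which is measurable for the completion.\<close>

lemma borel_measurable_completion_AE:
  assumes g: "g \<in> borel_measurable M" and fg: "AE x in M. f x = (g x :: 'b :: topological_space)"
  shows "f \<in> borel_measurable (completion M)"
proof (rule measurableI)
  fix A :: "'b set" assume A: "A \<in> sets borel"
  have "g -` A \<inter> space M \<in> sets (completion M)"
    using measurable_sets[OF g A] by simp
  moreover have "AE x in completion M. x \<in> g -` A \<inter> space M \<longleftrightarrow> x \<in> f -` A \<inter> space M"
    using AE_completion[OF fg] by eventually_elim simp
  ultimately show "f -` A \<inter> space (completion M) \<in> sets (completion M)"
    using completion.in_sets_AE[where M = M and A = "g -` A \<inter> space M" and B = "f -` A \<inter> space M"] by simp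
qed simp

text \<open>Jensen's inequality for the average of the \<open>a i\<close>.\<close>

lemma sum_powr_le:
  fixes a :: "'b \<Rightarrow> real"
  assumes fin: "finite S" and r: "1 \<le> r" and nonneg: "\<And>i. i \<in> S \<Longrightarrow> 0 \<le> a i"
  shows "(\<Sum>i\<in>S. a i) powr r \<le> real (card S) powr (r - 1) * (\<Sum>i\<in>S. a i powr r)"
proof -
  \<comment> \<open>Zero terms are dropped to apply convexity at positive arguments; the cardinality
    only decreases, and \<open>r - 1\<close> is nonnegative.\<close>
  define S' where "S' = {i \<in> S. a i \<noteq> 0}"
  have S': "finite S'" "S' \<subseteq> S" using fin by (auto simp: S'_def)
  have eq: "(\<Sum>i\<in>S. a i) = (\<Sum>i\<in>S'. a i)" "(\<Sum>i\<in>S. a i powr r) = (\<Sum>i\<in>S'. a i powr r)"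
    using fin by (auto simp: S'_def intro!: sum.mono_neutral_right)
  show ?thesis
  proof (cases "S' = {}")
    case True
    then show ?thesis unfolding eq by simp
  next
    case False
    define n where "n = real (card S')"
    have n: "n > 0" using False S' by (simp add: n_def card_gt_0_iff)
    have pos: "a i > 0" if "i \<in> S'" for i
      using nonneg[of i] that by (auto simp: S'_def)
    have "(\<Sum>i\<in>S'. (1 / n) *\<^sub>R a i) powr r \<le> (\<Sum>i\<in>S'. (1 / n) * (a i powr r))"
      using n pos by (intro convex_on_sum[OF S'(1) False powr_convex[OF r]]) (auto simp: n_def)
    then have "((\<Sum>i\<in>S'. a i) / n) powr r \<le> (\<Sum>i\<in>S'. a i powr r) / n"
      by (simp add: sum_divide_distrib)
    moreover have "((\<Sum>i\<in>S'. a i) / n) powr r = (\<Sum>i\<in>S'. a i) powr r / n powr r"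
      using n pos by (intro powr_divide)
    ultimately have "(\<Sum>i\<in>S'. a i) powr r \<le> n powr r / n * (\<Sum>i\<in>S'. a i powr r)"
      using n by (simp add: field_simps)
    also have "n powr r / n = n powr (r - 1)"
      using n by (simp add: powr_diff)
    also have "\<dots> * (\<Sum>i\<in>S'. a i powr r) \<le> real (card S) powr (r - 1) * (\<Sum>i\<in>S'. a i powr r)"
      using n r S' fin by (intro mult_right_mono powr_mono2 sum_nonneg) (auto simp: n_def card_mono)
    finally show ?thesis unfolding eq .
  qed
qed

context power_space
begin

abbreviation Lc :: "nat \<Rightarrow> (nat \<Rightarrow> 'a) measure" where
  "Lc k \<equiv> completion (L k)"

text \<open>The r-th power of a norm, possibly infinite. It is taken over the uncompleted product,
  where Fubini is available after passing to measurable representatives.\<close>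

definition wint :: "real \<Rightarrow> ((nat \<Rightarrow> 'a) \<Rightarrow> ennreal) \<Rightarrow> nat \<Rightarrow> ((nat \<Rightarrow> 'a) \<Rightarrow> real) \<Rightarrow> ennreal" where
  "wint r p k f = (\<integral>\<^sup>+x. ennreal (\<bar>f x\<bar> powr r) * p x \<partial>L k)"

definition symmetric_weight :: "nat \<Rightarrow> ((nat \<Rightarrow> 'a) \<Rightarrow> ennreal) \<Rightarrow> bool" where
  "symmetric_weight k p \<longleftrightarrow> (\<forall>\<pi>. \<pi> permutes {1..k} \<longrightarrow> (AE x in L k. p (x \<circ> \<pi>) = p x))"

text \<open>The inductions on \<open>N\<close> remove one variable at a time;
  \<open>marginal\<close> mirrors \<open>reduction\<close> and removes a block at once.\<close>

definition integrate_last :: "nat \<Rightarrow> ((nat \<Rightarrow> 'a) \<Rightarrow> ennreal) \<Rightarrow> (nat \<Rightarrow> 'a) \<Rightarrow> ennreal" where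
  "integrate_last N p x = (\<integral>\<^sup>+t. p (x(Suc N := t)) \<partial>M)"

definition marginal :: "nat \<Rightarrow> nat \<Rightarrow> ((nat \<Rightarrow> 'a) \<Rightarrow> ennreal) \<Rightarrow> (nat \<Rightarrow> 'a) \<Rightarrow> ennreal" where
  "marginal N k p x = (\<integral>\<^sup>+y. p (merge {1..k} {k+1..N} (x, y)) \<partial>PiM {k+1..N} (\<lambda>_. M))"

lemma wint_cong_AE: "AE x in L k. f x = g x \<Longrightarrow> wint r p k f = wint r p k g"
  unfolding wint_def by (rule nn_integral_cong_AE) (auto elim!: eventually_mono)

lemma wint_cong_weight: "AE x in L k. p x = q x \<Longrightarrow> wint r p k f = wint r q k f"
  unfolding wint_def by (rule nn_integral_cong_AE) (auto elim!: eventually_mono)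

lemma borel_representative:
  assumes "f \<in> borel_measurable (Lc k)"
  obtains g :: "(nat \<Rightarrow> 'a) \<Rightarrow> real" where "g \<in> borel_measurable (L k)" "AE x in L k. f x = g x"
  using completion_ex_borel_measurable_real[OF assms] by blast

lemma measurable_integrate_last [measurable]:
  "p \<in> borel_measurable (L (Suc N)) \<Longrightarrow> integrate_last N p \<in> borel_measurable (L N)"
  unfolding integrate_last_def[abs_def] by (rule measurable_integrate_out)

section \<open>Dropping and deleting a coordinate\<close>

lemma restrict_upd: "x \<in> space (L N) \<Longrightarrow> restrict (x(Suc N := t)) {1..N} = x"
  by (auto simp: space_PiM PiE_iff extensional_def fun_eq_iff restrict_def)

lemma measurable_restrict_Suc: "(\<lambda>x. restrict x {1..N}) \<in> measurable (L (Suc N)) (L N)"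
  by (rule measurable_restrict_subset) auto

text \<open>When the last coordinate is integrated first, the indicator of the cylinder over a null
  set \<open>A\<close> is \<open>indicator A x\<close> throughout the inner integral, which is 0 for
  almost every \<open>x\<close>.\<close>

lemma AE_restrict_Suc:
  assumes "AE y in L N. Q y"
  shows "AE x in L (Suc N). Q (restrict x {1..N})"
proof -
  obtain A where A: "{z \<in> space (L N). \<not> Q z} \<subseteq> A" "emeasure (L N) A = 0"
    and [measurable]: "A \<in> sets (L N)"
    using AE_E[OF assms] by blast
  note [measurable] = measurable_restrict_Suc
  have "AE x in L N. x \<notin> A" using A(2) by (intro AE_not_in) (auto simp: null_sets_def)
  then have "AE x in L N. (\<integral>\<^sup>+t. indicator A (restrict (x(Suc N := t)) {1..N}) \<partial>M) = 0"
    using AE_space by eventually_elim (simp only: restrict_upd, simp)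
  then have "(\<integral>\<^sup>+x. indicator A (restrict x {1..N}) \<partial>L (Suc N)) = 0"
    by (subst nn_integral_Suc) (auto simp: nn_integral_0_iff_AE measurable_integrate_out)
  then have "AE x in L (Suc N). indicator A (restrict x {1..N}) = (0::ennreal)"
    by (subst (asm) nn_integral_0_iff_AE) simp_all
  with AE_space show ?thesis
  proof eventually_elim
    case (elim x)
    then show ?case
      using A(1) measurable_space[OF measurable_restrict_Suc, of x N]
      by (auto simp: indicator_def split: if_splits)
  qed
qed

lemma AE_del:
  assumes "j \<in> {1..Suc N}" and "AE y in L N. Q y"
  shows "AE x in L (Suc N). Q (delete_coord N j x)"
  unfolding delete_coord_def by (rule AE_perm[OF skip_permutes[OF assms(1)] AE_restrict_Suc[OF assms(2)]])

lemma measurable_del: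
  assumes "j \<in> {1..Suc N}"
  shows "delete_coord N j \<in> measurable (L (Suc N)) (L N)"
  unfolding delete_coord_def[abs_def]
  using measurable_comp[OF measurable_perm[OF skip_permutes[OF assms]] measurable_restrict_Suc]
  by (simp add: comp_def)

lemma measurable_completion_del:
  fixes f :: "(nat \<Rightarrow> 'a) \<Rightarrow> real"
  assumes j: "j \<in> {1..Suc N}" and f: "f \<in> borel_measurable (Lc N)"
  shows "(\<lambda>x. f (delete_coord N j x)) \<in> borel_measurable (Lc (Suc N))"
proof -
  obtain g where [measurable]: "g \<in> borel_measurable (L N)" and g: "AE x in L N. f x = g x"
    using borel_representative[OF f] .
  note [measurable] = measurable_del[OF j]
  show ?thesis
    by (rule borel_measurable_completion_AE[of "\<lambda>x. g (delete_coord N j x)"])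
      (measurable, rule AE_del[OF j g])
qed

text \<open>By symmetry the weight may be evaluated at the permuted point
  \<open>x o skip N j\<close>. The whole integrand then depends on that point, the permutation drops
  out, and only the last coordinate is integrated away; so the value is the same for all
  \<open>j\<close>.\<close>

lemma nn_integral_del:
  assumes j: "j \<in> {1..Suc N}" and sym: "symmetric_weight (Suc N) p"
    and [measurable]: "f \<in> borel_measurable (L N)" "p \<in> borel_measurable (L (Suc N))"
  shows "(\<integral>\<^sup>+x. f (delete_coord N j x) * p x \<partial>L (Suc N)) = (\<integral>\<^sup>+x. f x * integrate_last N p x \<partial>L N)"
proof -
  note perm = skip_permutes[OF j]
  note [measurable] = measurable_restrict_Suc
  have "(\<integral>\<^sup>+x. f (delete_coord N j x) * p x \<partial>L (Suc N))
      = (\<integral>\<^sup>+x. f (restrict (x \<circ> skip N j) {1..N}) * p (x \<circ> skip N j) \<partial>L (Suc N))"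
    using sym perm unfolding symmetric_weight_def delete_coord_def
    by (intro nn_integral_cong_AE) (auto elim!: eventually_mono)
  also have "\<dots> = (\<integral>\<^sup>+x. f (restrict x {1..N}) * p x \<partial>L (Suc N))"
    by (rule nn_integral_perm[OF perm]) measurable
  also have "\<dots> = (\<integral>\<^sup>+x. (\<integral>\<^sup>+t. f (restrict (x(Suc N := t)) {1..N}) * p (x(Suc N := t)) \<partial>M) \<partial>L N)"
    by (rule nn_integral_Suc) measurable
  also have "\<dots> = (\<integral>\<^sup>+x. f x * integrate_last N p x \<partial>L N)"
  proof (rule nn_integral_cong)
    fix x assume x: "x \<in> space (L N)"
    have [measurable]: "(\<lambda>t. p (x(Suc N := t))) \<in> borel_measurable M"
      by (rule measurable_slice2[OF _ x]) measurable
    show "(\<integral>\<^sup>+t. f (restrict (x(Suc N := t)) {1..N}) * p (x(Suc N := t)) \<partial>M) = f x * integrate_last N p x"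
      unfolding integrate_last_def restrict_upd[OF x] by (rule nn_integral_cmult) measurable
  qed
  finally show ?thesis .
qed

text \<open>Jensen's inequality for \<open>N + 1\<close> terms costs a factor
  \<open>(N + 1) powr (r - 1)\<close>, and by \<open>nn_integral_del\<close> all these terms have
  the same integral. This is the contraction property of \<open>T / (N + 1)\<close>.\<close>

lemma deletion_sum_bound:
  fixes f :: "(nat \<Rightarrow> 'a) \<Rightarrow> real"
  assumes f: "f \<in> borel_measurable (Lc N)" and p[measurable]: "p \<in> borel_measurable (L (Suc N))"
    and sym: "symmetric_weight (Suc N) p" and r: "1 \<le> r"
  shows "deletion_sum N f \<in> borel_measurable (Lc (Suc N))"
    and "wint r p (Suc N) (deletion_sum N f) \<le> ennreal (real (Suc N) powr r) * wint r (integrate_last N p) N f"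
proof -
  show "deletion_sum N f \<in> borel_measurable (Lc (Suc N))"
    unfolding deletion_sum_def[abs_def]
    by (intro borel_measurable_sum measurable_completion_del f)
  obtain g where [measurable]: "g \<in> borel_measurable (L N)" and g: "AE x in L N. f x = g x"
    using borel_representative[OF f] .
  let ?n = "real (Suc N)" and ?J = "{1..Suc N}"
  have del [measurable]: "delete_coord N j \<in> measurable (L (Suc N)) (L N)" if "j \<in> ?J" for j
    using measurable_del[OF that] .
  have m [measurable]: "(\<lambda>x. ennreal (\<bar>g (delete_coord N j x)\<bar> powr r) * p x) \<in> borel_measurable (L (Suc N))"
    if "j \<in> ?J" for j
    using that by measurable
  have "AE x in L (Suc N). \<forall>j\<in>?J. f (delete_coord N j x) = g (delete_coord N j x)"
    using AE_del[OF _ g] by (simp add: AE_finite_all)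
  then have "AE x in L (Suc N). deletion_sum N f x = deletion_sum N g x"
    by (rule eventually_mono) (simp add: deletion_sum_def)
  then have "wint r p (Suc N) (deletion_sum N f) = wint r p (Suc N) (deletion_sum N g)"
    by (rule wint_cong_AE)
  also have "\<dots> \<le> (\<integral>\<^sup>+x. ennreal (?n powr (r - 1)) *
      (\<Sum>j\<in>?J. ennreal (\<bar>g (delete_coord N j x)\<bar> powr r) * p x) \<partial>L (Suc N))"
    unfolding wint_def
  proof (rule nn_integral_mono)
    fix x
    have "\<bar>deletion_sum N g x\<bar> powr r \<le> (\<Sum>j\<in>?J. \<bar>g (delete_coord N j x)\<bar>) powr r"
      using r by (intro powr_mono2) (auto simp only: deletion_sum_def intro!: sum_abs)
    also have "\<dots> \<le> real (card ?J) powr (r - 1) * (\<Sum>j\<in>?J. \<bar>g (delete_coord N j x)\<bar> powr r)"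
      by (rule sum_powr_le) (use r in auto)
    also have "real (card ?J) = ?n" by simp
    finally have "ennreal (\<bar>deletion_sum N g x\<bar> powr r)
        \<le> ennreal (?n powr (r - 1) * (\<Sum>j\<in>?J. \<bar>g (delete_coord N j x)\<bar> powr r))"
      by (rule ennreal_leI)
    then have "ennreal (\<bar>deletion_sum N g x\<bar> powr r)
        \<le> ennreal (?n powr (r - 1)) * (\<Sum>j\<in>?J. ennreal (\<bar>g (delete_coord N j x)\<bar> powr r))"
      by (subst sum_ennreal, simp, subst ennreal_mult[symmetric]) (simp_all only: powr_ge_zero sum_nonneg)
    then have "ennreal (\<bar>deletion_sum N g x\<bar> powr r) * p x
        \<le> ennreal (?n powr (r - 1)) * (\<Sum>j\<in>?J. ennreal (\<bar>g (delete_coord N j x)\<bar> powr r)) * p x"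
      by (rule mult_right_mono) simp
    then show "ennreal (\<bar>deletion_sum N g x\<bar> powr r) * p x
        \<le> ennreal (?n powr (r - 1)) * (\<Sum>j\<in>?J. ennreal (\<bar>g (delete_coord N j x)\<bar> powr r) * p x)"
      by (simp only: sum_distrib_right mult.assoc)
  qed
  also have "\<dots> = ennreal (?n powr (r - 1)) *
      (\<Sum>j\<in>?J. \<integral>\<^sup>+x. ennreal (\<bar>g (delete_coord N j x)\<bar> powr r) * p x \<partial>L (Suc N))"
    by (subst nn_integral_cmult, measurable, subst nn_integral_sum) auto
  also have "\<dots> = ennreal (?n powr (r - 1)) * (\<Sum>j\<in>?J. wint r (integrate_last N p) N g)"
    unfolding wint_def
    by (intro arg_cong2[where f = "(*)"] sum.cong refl nn_integral_del sym p) measurable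
  also have "\<dots> = (ennreal (?n powr (r - 1)) * ennreal ?n) * wint r (integrate_last N p) N g"
    by (simp add: ennreal_of_nat_eq_real_of_nat mult.assoc del: of_nat_Suc)
  also have "ennreal (?n powr (r - 1)) * ennreal ?n = ennreal (?n powr r)"
    by (simp only: ennreal_mult[symmetric] powr_ge_zero of_nat_0_le_iff) (simp add: powr_diff)
  also have "wint r (integrate_last N p) N g = wint r (integrate_last N p) N f"
    using g by (intro wint_cong_AE) (auto elim: eventually_mono)
  finally show "wint r p (Suc N) (deletion_sum N f) \<le> ennreal (?n powr r) * wint r (integrate_last N p) N f" .
qed

text \<open>A triangle inequality up to a factor 4, from elementary inequalities for r-th powers.
  The factor stands inside \<open>powr r\<close> and so is independent of \<open>r\<close>.\<close>

lemma wint_lincomb: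
  fixes f g :: "(nat \<Rightarrow> 'a) \<Rightarrow> real"
  assumes f: "f \<in> borel_measurable (Lc k)" and g: "g \<in> borel_measurable (Lc k)"
    and p [measurable]: "p \<in> borel_measurable (L k)" and r: "1 \<le> r"
    and A: "0 \<le> A" "wint r p k f \<le> ennreal (A powr r) * e"
    and B: "0 \<le> B" "wint r p k g \<le> ennreal (B powr r) * e"
  shows "wint r p k (\<lambda>x. a * f x + b * g x) \<le> ennreal ((4 * (\<bar>a\<bar> * A + \<bar>b\<bar> * B)) powr r) * e"
proof -
  obtain f' where [measurable]: "f' \<in> borel_measurable (L k)" and f': "AE x in L k. f x = f' x"
    using borel_representative[OF f] .
  obtain g' where [measurable]: "g' \<in> borel_measurable (L k)" and g': "AE x in L k. g x = g' x"
    using borel_representative[OF g] .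
  have real: "(s + t) powr r \<le> 2 powr r * (s powr r + t powr r)" if "0 \<le> s" "0 \<le> t" for s t :: real
  proof -
    have "(s + t) powr r \<le> (2 * max s t) powr r"
      using that r by (intro powr_mono2) auto
    also have "\<dots> = 2 powr r * (max s t) powr r"
      using that by (simp add: powr_mult)
    also have "\<dots> \<le> 2 powr r * (s powr r + t powr r)"
      by (intro mult_left_mono) (auto simp: max_def)
    finally show ?thesis .
  qed
  \<comment> \<open>Since \<open>r\<close> is at least 1, \<open>2 <= 2 powr r\<close>; together
    with \<open>real\<close> this accounts for \<open>4 = 2 * 2\<close>.\<close>
  have real2: "s powr r + t powr r \<le> 2 powr r * (s + t) powr r" if "0 \<le> s" "0 \<le> t" for s t :: real
  proof -
    have "s powr r + t powr r \<le> (s + t) powr r + (s + t) powr r"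
      using that r by (intro add_mono powr_mono2) auto
    also have "\<dots> = 2 powr 1 * (s + t) powr r" by simp
    also have "\<dots> \<le> 2 powr r * (s + t) powr r"
      using r by (intro mult_right_mono powr_mono) auto
    finally show ?thesis .
  qed
  have "wint r p k (\<lambda>x. a * f x + b * g x) = wint r p k (\<lambda>x. a * f' x + b * g' x)"
    using f' g' by (intro wint_cong_AE) (auto elim: eventually_elim2)
  also have "\<dots> \<le> (\<integral>\<^sup>+x. ennreal (2 powr r) * (ennreal (\<bar>a\<bar> powr r) * (ennreal (\<bar>f' x\<bar> powr r) * p x)
      + ennreal (\<bar>b\<bar> powr r) * (ennreal (\<bar>g' x\<bar> powr r) * p x)) \<partial>L k)"
    unfolding wint_def
  proof (rule nn_integral_mono)
    fix x
    have "\<bar>a * f' x + b * g' x\<bar> powr r \<le> (\<bar>a\<bar> * \<bar>f' x\<bar> + \<bar>b\<bar> * \<bar>g' x\<bar>) powr r"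
      using r by (intro powr_mono2) (auto simp: abs_mult[symmetric] intro: abs_triangle_ineq)
    also have "\<dots> \<le> 2 powr r * ((\<bar>a\<bar> * \<bar>f' x\<bar>) powr r + (\<bar>b\<bar> * \<bar>g' x\<bar>) powr r)"
      by (rule real) auto
    also have "\<dots> = 2 powr r * (\<bar>a\<bar> powr r * \<bar>f' x\<bar> powr r + \<bar>b\<bar> powr r * \<bar>g' x\<bar> powr r)"
      by (simp add: powr_mult)
    finally have "ennreal (\<bar>a * f' x + b * g' x\<bar> powr r)
        \<le> ennreal (2 powr r) * (ennreal (\<bar>a\<bar> powr r) * ennreal (\<bar>f' x\<bar> powr r)
          + ennreal (\<bar>b\<bar> powr r) * ennreal (\<bar>g' x\<bar> powr r))"
      by (simp add: ennreal_leI flip: ennreal_mult ennreal_plus)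
    then have "ennreal (\<bar>a * f' x + b * g' x\<bar> powr r) * p x
        \<le> ennreal (2 powr r) * (ennreal (\<bar>a\<bar> powr r) * ennreal (\<bar>f' x\<bar> powr r)
          + ennreal (\<bar>b\<bar> powr r) * ennreal (\<bar>g' x\<bar> powr r)) * p x"
      by (rule mult_right_mono) simp
    then show "ennreal (\<bar>a * f' x + b * g' x\<bar> powr r) * p x
        \<le> ennreal (2 powr r) * (ennreal (\<bar>a\<bar> powr r) * (ennreal (\<bar>f' x\<bar> powr r) * p x)
          + ennreal (\<bar>b\<bar> powr r) * (ennreal (\<bar>g' x\<bar> powr r) * p x))"
      by (simp only: distrib_right mult.assoc)
  qed
  also have "\<dots> = ennreal (2 powr r) * (ennreal (\<bar>a\<bar> powr r) * wint r p k f'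
      + ennreal (\<bar>b\<bar> powr r) * wint r p k g')"
    unfolding wint_def by (simp add: nn_integral_cmult nn_integral_add)
  also have "wint r p k f' = wint r p k f"
    using f' by (intro wint_cong_AE) (auto elim: eventually_mono)
  also have "wint r p k g' = wint r p k g"
    using g' by (intro wint_cong_AE) (auto elim: eventually_mono)
  also have "ennreal (2 powr r) * (ennreal (\<bar>a\<bar> powr r) * wint r p k f + ennreal (\<bar>b\<bar> powr r) * wint r p k g)
      \<le> ennreal (2 powr r) * (ennreal (\<bar>a\<bar> powr r) * (ennreal (A powr r) * e)
          + ennreal (\<bar>b\<bar> powr r) * (ennreal (B powr r) * e))"
    using A B by (intro mult_left_mono add_mono) auto
  also have "\<dots> = ennreal (2 powr r * ((\<bar>a\<bar> * A) powr r + (\<bar>b\<bar> * B) powr r)) * e"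
    using A B by (simp add: powr_mult ennreal_mult ennreal_plus distrib_right mult.assoc)
  also have "\<dots> \<le> ennreal ((4 * (\<bar>a\<bar> * A + \<bar>b\<bar> * B)) powr r) * e"
  proof (intro mult_right_mono ennreal_leI)
    have "2 powr r * ((\<bar>a\<bar> * A) powr r + (\<bar>b\<bar> * B) powr r)
        \<le> 2 powr r * (2 powr r * (\<bar>a\<bar> * A + \<bar>b\<bar> * B) powr r)"
      using A B by (intro mult_left_mono real2) auto
    also have "\<dots> = (2 * (2 * (\<bar>a\<bar> * A + \<bar>b\<bar> * B))) powr r"
      using A B by (simp only: powr_mult)
    finally show "2 powr r * ((\<bar>a\<bar> * A) powr r + (\<bar>b\<bar> * B) powr r)
        \<le> (4 * (\<bar>a\<bar> * A + \<bar>b\<bar> * B)) powr r" by simp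
  qed simp
  finally show ?thesis .
qed

lemma wint_scale:
  fixes f :: "(nat \<Rightarrow> 'a) \<Rightarrow> real"
  assumes f: "f \<in> borel_measurable (Lc k)" and p [measurable]: "p \<in> borel_measurable (L k)"
  shows "wint r p k (\<lambda>x. a * f x) = ennreal (\<bar>a\<bar> powr r) * wint r p k f"
proof -
  obtain f' where [measurable]: "f' \<in> borel_measurable (L k)" and f': "AE x in L k. f x = f' x"
    using borel_representative[OF f] .
  have "wint r p k (\<lambda>x. a * f x) = wint r p k (\<lambda>x. a * f' x)"
    using f' by (intro wint_cong_AE) (auto elim: eventually_mono)
  also have "\<dots> = ennreal (\<bar>a\<bar> powr r) * wint r p k f'"
    unfolding wint_def by (simp add: abs_mult powr_mult ennreal_mult mult.assoc nn_integral_cmult)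
  also have "wint r p k f' = wint r p k f"
    using f' by (intro wint_cong_AE) (auto elim: eventually_mono)
  finally show ?thesis .
qed

end

text \<open>Constants are kept as bases of r-th powers: chaining estimates multiplies them, and the
  r-th root taken at the end leaves a constant independent of \<open>r\<close>.\<close>

lemma ennreal_powr_chain:
  assumes "X \<le> ennreal (A powr r) * Y" "Y \<le> ennreal (B powr r) * e" "0 \<le> A" "0 \<le> B"
  shows "X \<le> ennreal ((A * B) powr r) * e"
proof -
  have "X \<le> ennreal (A powr r) * (ennreal (B powr r) * e)"
    using assms by (meson mult_left_mono order_trans zero_le)
  then show ?thesis using assms by (simp add: powr_mult ennreal_mult mult.assoc)
qed

section \<open>Marginals and the bound for the mean\<close>

context power_space
begin

lemma marginal_self:
  assumes "x \<in> space (L N)"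
  shows "marginal N N p x = p x"
proof -
  have "merge {1..N} {N+1..N} (x, y) = x" for y
    using assms by (auto simp: merge_def fun_eq_iff space_PiM PiE_iff extensional_def)
  then show ?thesis by (simp add: marginal_def PiM_empty nn_integral_count_space_finite)
qed

lemma measurable_merge_L:
  assumes "k \<le> N" "p \<in> borel_measurable (L N)"
  shows "(\<lambda>(x, y). p (merge {1..k} {k+1..N} (x, y)))
    \<in> borel_measurable (L k \<Otimes>\<^sub>M PiM {k+1..N} (\<lambda>_. M))"
proof -
  have "{1..k} \<union> {k+1..N} = {1..N}" using assms(1) by auto
  then have "merge {1..k} {k+1..N} \<in> measurable (L k \<Otimes>\<^sub>M PiM {k+1..N} (\<lambda>_. M)) (L N)"
    using measurable_merge[of "{1..k}" "{k+1..N}" "\<lambda>_. M"] by simp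
  from measurable_comp[OF this assms(2)] show ?thesis by (simp add: comp_def case_prod_unfold)
qed

lemma measurable_marginal:
  assumes "k \<le> N" "p \<in> borel_measurable (L N)"
  shows "marginal N k p \<in> borel_measurable (L k)"
proof -
  interpret J: sigma_finite_measure "PiM {k+1..N} (\<lambda>_. M)"
    by (rule sigma_finite) simp
  show ?thesis
    unfolding marginal_def[abs_def]
    using J.borel_measurable_nn_integral[OF measurable_merge_L[OF assms]] by simp
qed

text \<open>Fubini among the removed variables, with \<open>Suc N\<close> innermost. It lets
  inductions on \<open>N\<close> replace \<open>p\<close> by
  \<open>integrate_last N p\<close>.\<close>

lemma marginal_Suc:
  assumes k: "k \<le> N" and p: "p \<in> borel_measurable (L (Suc N))" and x: "x \<in> space (L k)"
  shows "marginal (Suc N) k p x = marginal N k (integrate_last N p) x"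
proof -
  have ins: "{k+1..Suc N} = insert (Suc N) {k+1..N}" using k by auto
  have m: "(\<lambda>y. p (merge {1..k} {k+1..Suc N} (x, y)))
      \<in> borel_measurable (PiM (insert (Suc N) {k+1..N}) (\<lambda>_. M))"
    using measurable_Pair2[OF measurable_merge_L[OF _ p, of k] x] k by (simp add: ins)
  have "marginal (Suc N) k p x = (\<integral>\<^sup>+y. (\<integral>\<^sup>+t. p (merge {1..k} {k+1..Suc N} (x, y(Suc N := t))) \<partial>M)
      \<partial>PiM {k+1..N} (\<lambda>_. M))"
    unfolding marginal_def using product_nn_integral_insert[OF _ _ m] by (simp add: ins)
  also have "\<dots> = marginal N k (integrate_last N p) x"
  proof -
    have "merge {1..k} {k+1..Suc N} (x, y(Suc N := t))
        = (merge {1..k} {k+1..N} (x, y))(Suc N := t)" for y t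
      using k by (auto simp: merge_def fun_eq_iff)
    then show ?thesis by (simp only: marginal_def integrate_last_def)
  qed
  finally show ?thesis .
qed

text \<open>A permutation of \<open>{1..N}\<close> fixes \<open>Suc N\<close>, so it also permutes
  \<open>{1..Suc N}\<close> and commutes with setting the last coordinate; the symmetry of
  \<open>p\<close> can then be integrated over that coordinate.\<close>

lemma symmetric_weight_integrate_last:
  assumes "symmetric_weight (Suc N) p"
  shows "symmetric_weight N (integrate_last N p)"
  unfolding symmetric_weight_def
proof (intro allI impI)
  fix \<pi> assume \<pi>: "\<pi> permutes {1..N}"
  have "\<pi> permutes {1..Suc N}" by (rule permutes_subset[OF \<pi>]) auto
  then have "AE x in L N. AE t in M. p (x(Suc N := t) \<circ> \<pi>) = p (x(Suc N := t))"
    using assms by (intro AE_Suc) (simp only: symmetric_weight_def)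
  moreover have "x(Suc N := t) \<circ> \<pi> = (x \<circ> \<pi>)(Suc N := t)" for x :: "nat \<Rightarrow> 'a" and t
    using permutes_not_in[OF \<pi>, of "Suc N"] permutes_in_image[OF \<pi>]
    by (auto simp: fun_eq_iff) (metis Suc_n_not_le_n atLeastAtMost_iff permutes_inj[OF \<pi>, THEN injD])
  ultimately show "AE x in L N. integrate_last N p (x \<circ> \<pi>) = integrate_last N p x"
    unfolding integrate_last_def by (auto elim!: eventually_mono intro!: nn_integral_cong_AE)
qed

text \<open>Part (i) before normalization. Applying \<open>deletion_sum\<close> and dividing by
  \<open>N + 1 - m\<close> raises \<open>N\<close> by one, and the factors
  \<open>(N + 1) / (N + 1 - m)\<close> build up the binomial coefficient.\<close>

lemma kernel_sum_bound:
  fixes u :: "(nat \<Rightarrow> 'a) \<Rightarrow> real"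
  assumes mN: "m \<le> N" and u: "u \<in> borel_measurable (Lc m)" and r: "1 \<le> r"
    and "p \<in> borel_measurable (L N)" "symmetric_weight N p"
  shows "kernel_sum m N u \<in> borel_measurable (Lc N) \<and>
    wint r p N (kernel_sum m N u) \<le> ennreal (real (N choose m) powr r) * wint r (marginal N m p) m u"
  using mN assms(4,5)
proof (induction N arbitrary: p rule: dec_induct)
  case base
  have eq: "AE x in L m. kernel_sum m m u x = u x"
    by (rule AE_I2) (simp add: kernel_sum_eq_self space_PiM PiE_restrict)
  obtain g where g: "g \<in> borel_measurable (L m)" "AE x in L m. u x = g x"
    using borel_representative[OF u] .
  have "AE x in L m. kernel_sum m m u x = g x"
    using eq g(2) by eventually_elim simp
  then have "kernel_sum m m u \<in> borel_measurable (Lc m)"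
    by (rule borel_measurable_completion_AE[OF g(1)])
  moreover have "wint r p m (kernel_sum m m u) = wint r (marginal m m p) m u"
    using wint_cong_AE[OF eq] wint_cong_weight[where k = m and p = p and q = "marginal m m p" and r = r and f = u]
    by (simp add: marginal_self AE_I2)
  ultimately show ?case by simp
next
  case (step N)
  \<comment> \<open>Reciprocal of the multiplicity in \<open>deletion_sum_kernel_sum\<close>,
    positive because \<open>m <= N\<close>.\<close>
  define a where "a = 1 / (1 + real N - real m)"
  have a: "a > 0" using step.hyps by (simp add: a_def)
  note [measurable] = step.prems(1)
  have IH: "kernel_sum m N u \<in> borel_measurable (Lc N)"
    "wint r (integrate_last N p) N (kernel_sum m N u)
      \<le> ennreal (real (N choose m) powr r) * wint r (marginal N m (integrate_last N p)) m u"
    using step.IH[of "integrate_last N p"] symmetric_weight_integrate_last[OF step.prems(2)] by auto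
  note del = deletion_sum_bound[OF IH(1) step.prems(1,2) r]
  have eq: "kernel_sum m (Suc N) u = (\<lambda>x. a * deletion_sum N (kernel_sum m N u) x)"
    using step.hyps by (simp add: fun_eq_iff deletion_sum_kernel_sum a_def)
  have red: "wint r (marginal N m (integrate_last N p)) m u = wint r (marginal (Suc N) m p) m u"
    using step.hyps step.prems(1) by (intro wint_cong_weight AE_I2) (simp add: marginal_Suc)
  have eq_choose: "real (Suc N choose m) * (1 + real N - real m) = real (Suc N) * real (N choose m)"
  proof -
    have "(Suc N - m) * (Suc N choose m) = Suc N * (N choose m)"
      using binomial_absorb_comp[of "Suc N" m] by simp
    then have "real ((Suc N - m) * (Suc N choose m)) = real (Suc N * (N choose m))"
      by (simp only:)
    moreover have "real (Suc N - m) = 1 + real N - real m"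
      using step.hyps by (simp add: of_nat_diff)
    ultimately show ?thesis by (simp only: of_nat_mult mult.commute)
  qed
  have choose: "a * (real (Suc N) * real (N choose m)) = real (Suc N choose m)"
  proof -
    have "a * (real (Suc N) * real (N choose m))
        = real (Suc N choose m) * (a * (1 + real N - real m))"
      by (simp only: eq_choose[symmetric] ac_simps)
    also have "a * (1 + real N - real m) = 1" using a by (simp add: a_def)
    finally show ?thesis by simp
  qed
  have "wint r p (Suc N) (kernel_sum m (Suc N) u)
      \<le> ennreal (a powr r) * wint r p (Suc N) (deletion_sum N (kernel_sum m N u))"
    using a unfolding eq by (simp add: wint_scale[OF del(1) step.prems(1)])
  then have "wint r p (Suc N) (kernel_sum m (Suc N) u)
      \<le> ennreal ((a * (real (Suc N) * real (N choose m))) powr r) * wint r (marginal N m (integrate_last N p)) m u"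
    by (rule ennreal_powr_chain[OF _ ennreal_powr_chain[OF del(2) IH(2)]]) (use a in auto)
  moreover have "kernel_sum m (Suc N) u \<in> borel_measurable (Lc (Suc N))"
    unfolding eq using del(1) by measurable
  ultimately show ?case unfolding choose red by simp
qed

subsection \<open>Slices with a uniform bound\<close>

text \<open>
  The function \<open>\<gamma>\<close> need not be measurable, so a sublevel set of \<open>1 / \<gamma>\<close> is only known not to be
  contained in a null set.
\<close>

definition nonnull :: "'a set \<Rightarrow> bool" where
  "nonnull B \<longleftrightarrow> B \<subseteq> space M \<and> (\<forall>S\<in>null_sets M. \<not> B \<subseteq> S)"

text \<open>Uniform and inverted form of the hypothesis on slices: \<open>c\<close> takes the place
  of \<open>1 / \<gamma>\<close> and is the same for all \<open>t\<close> in
  \<open>B\<close>.\<close>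

definition slices_dominate :: "nat \<Rightarrow> ((nat \<Rightarrow> 'a) \<Rightarrow> ennreal) \<Rightarrow> bool" where
  "slices_dominate N p \<longleftrightarrow> (\<exists>B c. nonnull B \<and> 0 \<le> c \<and>
     (\<forall>t\<in>B. AE x in L N. integrate_last N p x \<le> ennreal c * p (x(Suc N := t))))"

text \<open>Collects what passes from \<open>p\<close> to \<open>integrate_last\<close>, for the
  induction on \<open>N\<close>. Slices are compared only from two variables on.\<close>

definition admissible :: "nat \<Rightarrow> ((nat \<Rightarrow> 'a) \<Rightarrow> ennreal) \<Rightarrow> bool" where
  "admissible N p \<longleftrightarrow> p \<in> borel_measurable (L N) \<and> symmetric_weight N p \<and> (\<forall>k\<ge>1. N = Suc k \<longrightarrow> slices_dominate k p)"

text \<open>Otherwise a null set and the exceptional set of \<open>Q\<close> would together cover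
  \<open>B\<close>.\<close>

lemma nonnull_AE:
  assumes "nonnull B" "AE t in M. Q t"
  shows "nonnull {t \<in> B. Q t}"
proof -
  obtain A where A: "{t \<in> space M. \<not> Q t} \<subseteq> A" "A \<in> null_sets M"
    using assms(2) by (auto elim!: AE_E simp: null_sets_def)
  have "\<not> {t \<in> B. Q t} \<subseteq> S" if "S \<in> null_sets M" for S
  proof
    assume "{t \<in> B. Q t} \<subseteq> S"
    then have "B \<subseteq> A \<union> S" using A(1) assms(1) by (auto simp: nonnull_def)
    moreover have "A \<union> S \<in> null_sets M" using A(2) that by auto
    ultimately show False using assms(1) by (auto simp: nonnull_def)
  qed
  then show ?thesis using assms(1) by (auto simp: nonnull_def)
qed

text \<open>Were \<open>B\<close> contained in a measurable set of measure at most
  \<open>1 / (n + 1)\<close> for every \<open>n\<close>, the intersection of these sets would be a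
  null set containing \<open>B\<close>. The bound \<open>1 / K\<close> is matched to Markov's
  inequality in \<open>slice_bound\<close>.\<close>

lemma nonnull_quantitative:
  assumes "nonnull B"
  obtains K :: real where "1 \<le> K"
    "\<And>S. S \<in> sets M \<Longrightarrow> emeasure M S \<le> ennreal (1 / K) \<Longrightarrow> \<not> B \<subseteq> S"
proof (rule ccontr)
  assume neg: "\<not> thesis"
  have "\<exists>S\<in>sets M. emeasure M S \<le> ennreal (1 / real (Suc n)) \<and> B \<subseteq> S" for n
  proof (rule ccontr)
    assume "\<not> ?thesis"
    then show False using that[of "real (Suc n)"] neg by auto
  qed
  then obtain S where S: "\<And>n. S n \<in> sets M" "\<And>n. emeasure M (S n) \<le> ennreal (1 / real (Suc n))"
    "\<And>n. B \<subseteq> S n"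
    by metis
  have "emeasure M (\<Inter>n. S n) \<le> ennreal (1 / real (Suc n))" for n
    using S(1) by (intro order_trans[OF emeasure_mono S(2)]) auto
  moreover have "(\<lambda>n. ennreal (1 / real (Suc n))) \<longlonglongrightarrow> ennreal 0"
    using LIMSEQ_inverse_real_of_nat by (intro tendsto_ennrealI) (simp add: inverse_eq_divide)
  ultimately have "emeasure M (\<Inter>n. S n) \<le> ennreal 0"
    by (intro LIMSEQ_le_const) auto
  then have "(\<Inter>n. S n) \<in> null_sets M" using S(1) by (auto simp: null_sets_def)
  moreover have "B \<subseteq> (\<Inter>n. S n)" using S(3) by auto
  ultimately show False using assms by (auto simp: nonnull_def)
qed

text \<open>Write points as \<open>(x, s, t)\<close> and \<open>p1\<close> for the integrated
  weight. The bound on the slice at \<open>t\<close> reads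
  \<open>p1 (x, s) <= c * p (x, s, t)\<close>. Symmetry exchanges \<open>s\<close> and
  \<open>t\<close> on the right, and integration over \<open>s\<close> gives the bound on the slice
  of \<open>p1\<close> at \<open>t\<close>.\<close>

lemma slices_dominate_integrate_last:
  assumes dom: "slices_dominate (Suc N) p" and sym: "symmetric_weight (Suc (Suc N)) p"
    and p: "p \<in> borel_measurable (L (Suc (Suc N)))"
  shows "slices_dominate N (integrate_last (Suc N) p)"
proof -
  obtain B c where B: "nonnull B" and c: "0 \<le> c"
    and le: "\<And>t. t \<in> B \<Longrightarrow> AE y in L (Suc N). integrate_last (Suc N) p y \<le> ennreal c * p (y(Suc (Suc N) := t))"
    using dom by (auto simp: slices_dominate_def)
  let ?\<tau> = "Transposition.transpose (Suc N) (Suc (Suc N))"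
  have swap: "x(Suc N := s, Suc (Suc N) := t) \<circ> ?\<tau> = x(Suc N := t, Suc (Suc N) := s)"
    for x :: "nat \<Rightarrow> 'a" and s t
    by (auto simp: fun_eq_iff Transposition.transpose_def)
  have "?\<tau> permutes {1..Suc (Suc N)}" by (rule permutes_swap_id) auto
  then have "AE z in L (Suc (Suc N)). p (z \<circ> ?\<tau>) = p z"
    using sym by (simp add: symmetric_weight_def)
  then have "AE t in M. AE y in L (Suc N). p (y(Suc (Suc N) := t) \<circ> ?\<tau>) = p (y(Suc (Suc N) := t))"
    by (rule AE_Suc_rev)
  then have "AE t in M. AE x in L N. AE s in M.
      p (x(Suc N := t, Suc (Suc N) := s)) = p (x(Suc N := s, Suc (Suc N) := t))" (is "AE t in M. ?Q t")
    by (rule eventually_mono) (drule AE_Suc, simp only: swap)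
  \<comment> \<open>The exchange of \<open>s\<close> and \<open>t\<close> is valid for almost every
    \<open>t\<close> only, so the exceptional values are removed from \<open>B\<close>.\<close>
  then have B': "nonnull {t \<in> B. ?Q t}" by (rule nonnull_AE[OF B])
  have "AE x in L N. integrate_last N (integrate_last (Suc N) p) x \<le> ennreal c * integrate_last (Suc N) p (x(Suc N := t))"
    if t: "t \<in> B" "?Q t" for t
  proof -
    have tM: "t \<in> space M" using t B by (auto simp: nonnull_def)
    show ?thesis
      using AE_space AE_Suc[OF le[OF t(1)]] t(2)
    proof eventually_elim
      case (elim x)
      have m: "(\<lambda>s. p (x(Suc N := t, Suc (Suc N) := s))) \<in> borel_measurable M"
        by (rule measurable_slice2[OF p]) (rule upd_in_space[OF elim(1) tM])
      have "integrate_last N (integrate_last (Suc N) p) x \<le> (\<integral>\<^sup>+s. ennreal c * p (x(Suc N := t, Suc (Suc N) := s)) \<partial>M)"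
        unfolding integrate_last_def[of N]
      proof (rule nn_integral_mono_AE)
        show "AE s in M. integrate_last (Suc N) p (x(Suc N := s)) \<le> ennreal c * p (x(Suc N := t, Suc (Suc N) := s))"
          using elim(2,3) by eventually_elim simp
      qed
      also have "\<dots> = ennreal c * integrate_last (Suc N) p (x(Suc N := t))"
        unfolding integrate_last_def[of "Suc N"] by (rule nn_integral_cmult[OF m])
      finally show ?case .
    qed
  qed
  then show ?thesis using B' c unfolding slices_dominate_def by blast
qed

lemma admissible_integrate_last:
  assumes "admissible (Suc N) p"
  shows "admissible N (integrate_last N p)"
  unfolding admissible_def
proof (intro conjI allI impI)
  show "integrate_last N p \<in> borel_measurable (L N)"
    using assms by (intro measurable_integrate_last) (simp add: admissible_def)
  show "symmetric_weight N (integrate_last N p)"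
    using assms by (intro symmetric_weight_integrate_last) (simp add: admissible_def)
  show "slices_dominate k (integrate_last N p)" if "1 \<le> k" "N = Suc k" for k
    using assms that slices_dominate_integrate_last by (auto simp: admissible_def)
qed

text \<open>Let \<open>h t\<close> be the weighted integral over the slice at \<open>t\<close>. By
  Markov's inequality the set where \<open>h\<close> exceeds \<open>K\<close> times its integral has
  measure at most \<open>1 / K\<close>, too small to cover \<open>B\<close>. For \<open>t\<close> in
  \<open>B\<close> outside it, the weight of the slice is traded for the integrated weight at the
  cost of \<open>c\<close>.\<close>

lemma slice_bound:
  assumes dom: "slices_dominate N p" and p [measurable]: "p \<in> borel_measurable (L (Suc N))"
  obtains C :: real where "0 \<le> C"
    "\<And>r f. 1 \<le> r \<Longrightarrow> f \<in> borel_measurable (Lc (Suc N)) \<Longrightarrow> wint r p (Suc N) f < \<infinity> \<Longrightarrow>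
       \<exists>t\<in>space M. (\<lambda>x. f (x(Suc N := t)) :: real) \<in> borel_measurable (Lc N) \<and>
         wint r (integrate_last N p) N (\<lambda>x. f (x(Suc N := t))) \<le> ennreal (C powr r) * wint r p (Suc N) f"
proof -
  obtain B c where B: "nonnull B" and c: "0 \<le> c"
    and le: "\<And>t. t \<in> B \<Longrightarrow> AE x in L N. integrate_last N p x \<le> ennreal c * p (x(Suc N := t))"
    using dom by (auto simp: slices_dominate_def)
  obtain K :: real where K: "1 \<le> K"
    and big: "\<And>S. S \<in> sets M \<Longrightarrow> emeasure M S \<le> ennreal (1 / K) \<Longrightarrow> \<not> B \<subseteq> S"
    using nonnull_quantitative[OF B] by blast
  \<comment> \<open>The maximum with 1 gives \<open>c * K <= C <= C powr r\<close> for every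
    \<open>r >= 1\<close>, so \<open>C\<close> is fixed before \<open>r\<close> and
    \<open>f\<close>.\<close>
  define C where "C = max 1 (c * K)"
  show thesis
  proof (rule that[of C])
    show "0 \<le> C" by (simp add: C_def)
  next
    fix r and f :: "(nat \<Rightarrow> 'a) \<Rightarrow> real"
    assume r: "1 \<le> r" and f: "f \<in> borel_measurable (Lc (Suc N))" and fin: "wint r p (Suc N) f < \<infinity>"
    obtain e where e: "0 \<le> e" "wint r p (Suc N) f = ennreal e"
      using fin by (cases "wint r p (Suc N) f") auto
    obtain g where g [measurable]: "g \<in> borel_measurable (L (Suc N))" and fg: "AE x in L (Suc N). f x = g x"
      using borel_representative[OF f] .
    define h where "h t = (\<integral>\<^sup>+x. ennreal (\<bar>g (x(Suc N := t))\<bar> powr r) * p (x(Suc N := t)) \<partial>L N)" for t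
    have h [measurable]: "h \<in> borel_measurable M"
      unfolding h_def[abs_def]
      by (rule measurable_integrate_out_rev[of "\<lambda>x. ennreal (\<bar>g x\<bar> powr r) * p x"]) measurable
    have "(\<integral>\<^sup>+t. h t \<partial>M) = wint r p (Suc N) g"
      unfolding h_def wint_def
      by (rule nn_integral_Suc_rev[of "\<lambda>x. ennreal (\<bar>g x\<bar> powr r) * p x", symmetric]) measurable
    also have "\<dots> = ennreal e"
      unfolding e(2)[symmetric] using fg by (intro wint_cong_AE) (auto elim: eventually_mono)
    finally have int_h: "(\<integral>\<^sup>+t. h t \<partial>M) = ennreal e" .
    define S where "S = {t \<in> space M. ennreal (K * e) < h t}"
    have S: "S \<in> sets M" unfolding S_def by measurable
    have emS: "emeasure M S \<le> ennreal (1 / K)"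
    proof (cases "e = 0")
      case True
      then have "AE t in M. h t = 0" using int_h by (simp add: nn_integral_0_iff_AE)
      then have "AE t in M. t \<notin> S" by (rule eventually_mono) (simp add: S_def)
      then have "S \<in> null_sets M" using S by (simp add: AE_iff_null_sets)
      then show ?thesis by (simp add: null_sets_def)
    next
      case False
      then have e0: "e > 0" using e by simp
      have "1 \<le> ennreal (1 / (K * e)) * h t" if "t \<in> S" for t
      proof -
        have "1 = ennreal (1 / (K * e)) * ennreal (K * e)"
          using e0 K by (simp flip: ennreal_mult)
        also have "\<dots> \<le> ennreal (1 / (K * e)) * h t"
          using that by (intro mult_left_mono) (auto simp: S_def)
        finally show ?thesis .
      qed
      then have "S \<subseteq> {t \<in> space M. 1 \<le> ennreal (1 / (K * e)) * h t}"
        by (auto simp: S_def)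
      then have "emeasure M S \<le> emeasure M {t \<in> space M. 1 \<le> ennreal (1 / (K * e)) * h t}"
        by (intro emeasure_mono) measurable
      also have "\<dots> \<le> ennreal (1 / (K * e)) * (\<integral>\<^sup>+t. h t * indicator (space M) t \<partial>M)"
        by (rule nn_integral_Markov_inequality) auto
      also have "(\<integral>\<^sup>+t. h t * indicator (space M) t \<partial>M) = ennreal e"
        unfolding int_h[symmetric] by (rule nn_integral_cong) simp
      also have "ennreal (1 / (K * e)) * ennreal e = ennreal (1 / K)"
        using e0 K by (simp flip: ennreal_mult)
      finally show ?thesis .
    qed
    have "AE t in M. AE x in L N. f (x(Suc N := t)) = g (x(Suc N := t))"
      by (rule AE_Suc_rev[OF fg])
    \<comment> \<open>Values of \<open>t\<close> at which the slices of \<open>f\<close> and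
      \<open>g\<close> do not agree almost everywhere must be avoided as well; they add only a null
      set.\<close>
    then obtain Z where Z: "{t \<in> space M. \<not> (AE x in L N. f (x(Suc N := t)) = g (x(Suc N := t)))} \<subseteq> Z"
      "Z \<in> null_sets M"
      by (auto elim!: AE_E simp: null_sets_def)
    have "\<not> B \<subseteq> S \<union> Z"
    proof (rule big)
      show "S \<union> Z \<in> sets M" using S Z(2) by auto
      show "emeasure M (S \<union> Z) \<le> ennreal (1 / K)"
        using emS by (simp add: emeasure_Un_null_set S Z(2))
    qed
    then obtain t where t: "t \<in> B" "t \<notin> S" "t \<notin> Z" by auto
    have tM: "t \<in> space M" using t B by (auto simp: nonnull_def)
    have fgt: "AE x in L N. f (x(Suc N := t)) = g (x(Suc N := t))"
      using t Z(1) tM by auto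
    have gt [measurable]: "(\<lambda>x. g (x(Suc N := t))) \<in> borel_measurable (L N)"
      by (rule measurable_slice[OF g tM])
    have pt [measurable]: "(\<lambda>x. p (x(Suc N := t))) \<in> borel_measurable (L N)"
      by (rule measurable_slice[OF p tM])
    have "wint r (integrate_last N p) N (\<lambda>x. f (x(Suc N := t))) = wint r (integrate_last N p) N (\<lambda>x. g (x(Suc N := t)))"
      by (rule wint_cong_AE[OF fgt])
    also have "\<dots> \<le> (\<integral>\<^sup>+x. ennreal c * (ennreal (\<bar>g (x(Suc N := t))\<bar> powr r) * p (x(Suc N := t))) \<partial>L N)"
      unfolding wint_def
    proof (rule nn_integral_mono_AE)
      show "AE x in L N. ennreal (\<bar>g (x(Suc N := t))\<bar> powr r) * integrate_last N p x
          \<le> ennreal c * (ennreal (\<bar>g (x(Suc N := t))\<bar> powr r) * p (x(Suc N := t)))"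
        using le[OF t(1)]
      proof eventually_elim
        case (elim x)
        from mult_left_mono[OF this, of "ennreal (\<bar>g (x(Suc N := t))\<bar> powr r)"]
        show ?case by (simp add: ac_simps)
      qed
    qed
    also have "\<dots> = ennreal c * h t"
      unfolding h_def by (rule nn_integral_cmult) measurable
    also have "\<dots> \<le> ennreal c * ennreal (K * e)"
      using t(2) tM by (intro mult_left_mono) (auto simp: S_def not_less)
    also have "\<dots> = ennreal (c * K) * ennreal e"
      using c K e by (simp add: mult.assoc flip: ennreal_mult)
    also have "\<dots> \<le> ennreal (C powr r) * ennreal e"
    proof (intro mult_right_mono ennreal_leI)
      have "c * K \<le> C powr 1" by (simp add: C_def)
      also have "\<dots> \<le> C powr r" using r by (intro powr_mono) (auto simp: C_def)
      finally show "c * K \<le> C powr r" .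
    qed simp
    finally have "wint r (integrate_last N p) N (\<lambda>x. f (x(Suc N := t)))
        \<le> ennreal (C powr r) * wint r p (Suc N) f" by (simp only: e(2))
    then show "\<exists>t\<in>space M. (\<lambda>x. f (x(Suc N := t))) \<in> borel_measurable (Lc N) \<and>
         wint r (integrate_last N p) N (\<lambda>x. f (x(Suc N := t))) \<le> ennreal (C powr r) * wint r p (Suc N) f"
      using tM borel_measurable_completion_AE[OF gt fgt] by blast
  qed
qed


subsection \<open>Bounds for the kernel\<close>

text \<open>Freezing the argument of a kernel of order 1 leads to this start of the induction.
  \<open>L 0\<close> has the single point \<open>\<lambda>_. undefined\<close>, so \<open>u\<close>
  is a constant and the marginal is the total mass of \<open>p\<close>.\<close>

lemma kernel_bound_0:
  fixes u :: "(nat \<Rightarrow> 'a) \<Rightarrow> real"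
  assumes [measurable]: "p \<in> borel_measurable (L N)"
  shows "u \<in> borel_measurable (Lc 0)"
    and "wint r (marginal N 0 p) 0 u = wint r p N (kernel_sum 0 N u)"
proof -
  show "u \<in> borel_measurable (Lc 0)"
    by (rule borel_measurable_completion_AE[of "\<lambda>_. u (\<lambda>_. undefined)"])
      (auto simp: space_PiM_empty intro!: AE_I2)
  have "merge {1..0} {1..N} (\<lambda>_. undefined, y) = y" if "y \<in> space (L N)" for y
    using that by (auto simp: merge_def fun_eq_iff space_PiM PiE_iff extensional_def)
  then have "marginal N 0 p (\<lambda>_. undefined) = (\<integral>\<^sup>+y. p y \<partial>L N)"
    unfolding marginal_def add_0 by (intro nn_integral_cong arg_cong[of _ _ p])
  moreover have "wint r (marginal N 0 p) 0 u = ennreal (\<bar>u (\<lambda>_. undefined)\<bar> powr r) * marginal N 0 p (\<lambda>_. undefined)"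
    by (simp add: wint_def PiM_empty nn_integral_count_space_finite)
  ultimately show "wint r (marginal N 0 p) 0 u = wint r p N (kernel_sum 0 N u)"
    unfolding wint_def kernel_sum_0 by (simp add: nn_integral_cmult)
qed

lemma kernel_bound_self:
  fixes u :: "(nat \<Rightarrow> 'a) \<Rightarrow> real"
  assumes "kernel_sum m m u \<in> borel_measurable (Lc m)"
  shows "u \<in> borel_measurable (Lc m)" and "wint r (marginal m m p) m u = wint r p m (kernel_sum m m u)"
proof -
  have eq: "AE x in L m. u x = kernel_sum m m u x"
    by (rule AE_I2) (simp add: kernel_sum_eq_self space_PiM PiE_restrict)
  obtain g where g: "g \<in> borel_measurable (L m)" "AE x in L m. kernel_sum m m u x = g x"
    using borel_representative[OF assms] .
  have "AE x in L m. u x = g x"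
    using eq g(2) by eventually_elim simp
  then show "u \<in> borel_measurable (Lc m)"
    by (rule borel_measurable_completion_AE[OF g(1)])
  show "wint r (marginal m m p) m u = wint r p m (kernel_sum m m u)"
    using wint_cong_AE[OF eq] wint_cong_weight[where k = m and p = p and q = "marginal m m p" and r = r and f = u]
    by (simp add: marginal_self AE_I2)
qed

text \<open>The induction on \<open>m\<close> is outermost, with \<open>N\<close> and
  \<open>p\<close> arbitrary: the lower-order kernel \<open>v\<close> is treated on
  \<open>Suc N\<close> variables with weight \<open>p\<close>, whereas \<open>u\<close> is treated
  on \<open>N\<close> variables with the integrated weight. The constant is chosen before
  \<open>r\<close> and \<open>u\<close>.\<close>

lemma kernel_bound:
  assumes "m \<le> N" "admissible N p"
  shows "\<exists>C\<ge>0. \<forall>r\<ge>1. \<forall>u. kernel_sum m N u \<in> borel_measurable (Lc N) \<longrightarrow>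
    wint r p N (kernel_sum m N u) < \<infinity> \<longrightarrow> u \<in> borel_measurable (Lc m) \<and>
    wint r (marginal N m p) m u \<le> ennreal (C powr r) * wint r p N (kernel_sum m N u)"
  using assms
proof (induction m arbitrary: N p)
  case 0
  then have "p \<in> borel_measurable (L N)" by (simp add: admissible_def)
  then show ?case
    by (intro exI[of _ "1::real"] conjI allI impI kernel_bound_0(1)) (simp_all add: kernel_bound_0(2))
next
  case (Suc m)
  from Suc.prems show ?case
  proof (induction N arbitrary: p rule: dec_induct)
    case base
    show ?case
      by (intro exI[of _ "1::real"]) (simp add: kernel_bound_self)
  next
    case (step N)
    have p: "p \<in> borel_measurable (L (Suc N))" and sym: "symmetric_weight (Suc N) p" and dom: "slices_dominate N p"
      using step.prems step.hyps by (auto simp: admissible_def)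
    have mN: "m \<le> N" using step.hyps by simp
    obtain C1 where C1: "0 \<le> C1" and slice: "\<And>r f. 1 \<le> r \<Longrightarrow> f \<in> borel_measurable (Lc (Suc N)) \<Longrightarrow>
       wint r p (Suc N) f < \<infinity> \<Longrightarrow>
       \<exists>t\<in>space M. (\<lambda>x. f (x(Suc N := t)) :: real) \<in> borel_measurable (Lc N) \<and>
         wint r (integrate_last N p) N (\<lambda>x. f (x(Suc N := t))) \<le> ennreal (C1 powr r) * wint r p (Suc N) f"
      using slice_bound[OF dom p] by metis
    obtain C2 where C2: "0 \<le> C2" and IH_m: "\<And>r v. 1 \<le> r \<Longrightarrow>
       kernel_sum m (Suc N) v \<in> borel_measurable (Lc (Suc N)) \<Longrightarrow>
       wint r p (Suc N) (kernel_sum m (Suc N) v) < \<infinity> \<Longrightarrow> v \<in> borel_measurable (Lc m) \<and>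
       wint r (marginal (Suc N) m p) m v \<le> ennreal (C2 powr r) * wint r p (Suc N) (kernel_sum m (Suc N) v)"
      using Suc.IH[of "Suc N" p] mN step.prems by fastforce
    obtain C3 where C3: "0 \<le> C3" and IH_N: "\<And>r u. 1 \<le> r \<Longrightarrow>
       kernel_sum (Suc m) N u \<in> borel_measurable (Lc N) \<Longrightarrow>
       wint r (integrate_last N p) N (kernel_sum (Suc m) N u) < \<infinity> \<Longrightarrow> u \<in> borel_measurable (Lc (Suc m)) \<and>
       wint r (marginal N (Suc m) (integrate_last N p)) (Suc m) u
         \<le> ennreal (C3 powr r) * wint r (integrate_last N p) N (kernel_sum (Suc m) N u)"
      using step.IH[OF admissible_integrate_last[OF step.prems]] by blast
    have p1: "integrate_last N p \<in> borel_measurable (L N)" and sym1: "symmetric_weight N (integrate_last N p)"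
      using p sym by (auto intro: measurable_integrate_last symmetric_weight_integrate_last)
    \<comment> \<open>Multiplicity for sums of order \<open>m\<close> under deletion from
      \<open>Suc N\<close> variables; for order \<open>Suc m\<close> it is
      \<open>d - 1\<close>.\<close>
    define d where "d = 1 + real N - real m"
    have d: "d > 0" using mN by (simp add: d_def)
    \<comment> \<open>Relative to the norm of the given sum, \<open>D\<close>, \<open>F\<close> and
      \<open>G\<close> bound in turn the norms of \<open>kernel_sum m (Suc N) v\<close>,
      \<open>kernel_sum m N v\<close> and \<open>kernel_sum (Suc m) N u\<close>.\<close>
    define D where "D = 4 * (\<bar>1 / d\<bar> * (real (Suc N) * C1) + \<bar>- (d - 1) / d\<bar> * 1)"
    define F where "F = real (N choose m) * (C2 * D)"
    define G where "G = 4 * (\<bar>1\<bar> * C1 + \<bar>-1\<bar> * F)"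
    have nonneg: "0 \<le> D" "0 \<le> F" "0 \<le> G"
      using C1 C2 by (auto simp: D_def F_def G_def)
    show ?case
    proof (intro exI[of _ "C3 * G"] conjI allI impI)
      show "0 \<le> C3 * G" using C3 nonneg by simp
    next
      fix r :: real and u :: "(nat \<Rightarrow> 'a) \<Rightarrow> real"
      assume r: "1 \<le> r" and U: "kernel_sum (Suc m) (Suc N) u \<in> borel_measurable (Lc (Suc N))"
        and fin: "wint r p (Suc N) (kernel_sum (Suc m) (Suc N) u) < \<infinity>"
      define e where "e = wint r p (Suc N) (kernel_sum (Suc m) (Suc N) u)"
      \<comment> \<open>Both induction hypotheses ask for finiteness, which every bound by a real
        multiple of \<open>e\<close> supplies.\<close>
      have fin_e: "X < \<infinity>" if "X \<le> ennreal a * e" for X a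
        using that fin by (auto simp: e_def ennreal_mult_less_top intro: le_less_trans)
      obtain t where t: "t \<in> space M"
        and W': "(\<lambda>x. kernel_sum (Suc m) (Suc N) u (x(Suc N := t))) \<in> borel_measurable (Lc N)"
          "wint r (integrate_last N p) N (\<lambda>x. kernel_sum (Suc m) (Suc N) u (x(Suc N := t))) \<le> ennreal (C1 powr r) * e"
        using slice[OF r U fin] by (auto simp: e_def)
      define v where "v = (\<lambda>y. u (y(Suc m := t)))"
      define W where "W = (\<lambda>x. kernel_sum (Suc m) N u x + kernel_sum m N v x)"
      have W_eq: "(\<lambda>x. kernel_sum (Suc m) (Suc N) u (x(Suc N := t))) = W"
        by (simp add: fun_eq_iff kernel_sum_Suc kernel_sum_upd W_def v_def)
      note W = W'[unfolded W_eq]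
      \<comment> \<open>The deletion identity for \<open>W\<close>, solved for the sum of
        \<open>v\<close>; this divides by \<open>d > 0\<close>.\<close>
      have V_eq: "kernel_sum m (Suc N) v = (\<lambda>x. 1 / d * deletion_sum N W x + (- (d - 1) / d) * kernel_sum (Suc m) (Suc N) u x)"
      proof
        fix x
        have "deletion_sum N W x = deletion_sum N (kernel_sum (Suc m) N u) x + deletion_sum N (kernel_sum m N v) x"
          by (simp only: deletion_sum_def W_def sum.distrib)
        also have "\<dots> = (d - 1) * kernel_sum (Suc m) (Suc N) u x + d * kernel_sum m (Suc N) v x"
          by (simp add: deletion_sum_kernel_sum d_def)
        finally show "kernel_sum m (Suc N) v x = 1 / d * deletion_sum N W x + (- (d - 1) / d) * kernel_sum (Suc m) (Suc N) u x"
          using d by (simp add: field_simps)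
      qed
      note delW = deletion_sum_bound[OF W(1) p sym r]
      have V: "kernel_sum m (Suc N) v \<in> borel_measurable (Lc (Suc N))"
        unfolding V_eq using delW(1) U by measurable
      have "wint r p (Suc N) (kernel_sum m (Suc N) v) \<le> ennreal (D powr r) * e"
        unfolding V_eq D_def
        by (rule wint_lincomb[OF delW(1) U p r _ ennreal_powr_chain[OF delW(2) W(2)]])
          (use C1 in \<open>auto simp: e_def\<close>)
      note Vb = this fin_e[OF this]
      note v = IH_m[OF r V Vb(2)]
      \<comment> \<open>The two ways of reducing to \<open>m\<close> variables agree, which carries
        the estimate of \<open>v\<close> over to the integrated weight on \<open>N\<close>
        variables.\<close>
      have red: "wint r (marginal N m (integrate_last N p)) m v = wint r (marginal (Suc N) m p) m v"
        using mN p by (intro wint_cong_weight AE_I2) (simp add: marginal_Suc)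
      have "wint r (marginal N m (integrate_last N p)) m v \<le> ennreal ((C2 * D) powr r) * e"
        unfolding red by (rule ennreal_powr_chain[OF _ Vb(1)]) (use v C2 nonneg in auto)
      moreover have V': "kernel_sum m N v \<in> borel_measurable (Lc N) \<and> wint r (integrate_last N p) N (kernel_sum m N v)
          \<le> ennreal (real (N choose m) powr r) * wint r (marginal N m (integrate_last N p)) m v"
        using v by (intro kernel_sum_bound[OF mN _ r p1 sym1]) simp
      ultimately have Vb': "wint r (integrate_last N p) N (kernel_sum m N v) \<le> ennreal (F powr r) * e"
        unfolding F_def by (intro ennreal_powr_chain[of _ "real (N choose m)"]) (use C2 nonneg in auto)
      have K_eq: "kernel_sum (Suc m) N u = (\<lambda>x. 1 * W x + (-1) * kernel_sum m N v x)"
        by (simp add: W_def fun_eq_iff)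
      have K: "kernel_sum (Suc m) N u \<in> borel_measurable (Lc N)"
        unfolding K_eq using W(1) conjunct1[OF V'] by measurable
      have "wint r (integrate_last N p) N (kernel_sum (Suc m) N u) \<le> ennreal (G powr r) * e"
        unfolding K_eq G_def
        by (rule wint_lincomb[OF W(1) conjunct1[OF V'] p1 r C1 W(2) nonneg(2) Vb'])
      note Kb = this fin_e[OF this]
      note u = IH_N[OF r K Kb(2)]
      show "u \<in> borel_measurable (Lc (Suc m))" using u by simp
      have red': "wint r (marginal (Suc N) (Suc m) p) (Suc m) u = wint r (marginal N (Suc m) (integrate_last N p)) (Suc m) u"
        using step.hyps p by (intro wint_cong_weight AE_I2) (simp add: marginal_Suc)
      show "wint r (marginal (Suc N) (Suc m) p) (Suc m) u
          \<le> ennreal ((C3 * G) powr r) * wint r p (Suc N) (kernel_sum (Suc m) (Suc N) u)"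
        unfolding red' e_def[symmetric]
        by (rule ennreal_powr_chain[OF _ Kb(1)]) (use u C3 nonneg in auto)
    qed
  qed
qed


subsection \<open>Densities and their reductions\<close>

lemma power_measure_eq: "power_measure M {1..k} = Lc k"
  by (simp add: power_measure_def)

lemma AE_merge:
  assumes k: "k \<le> N" and Q: "AE z in L N. Q z"
  shows "AE x in L k. AE y in PiM {k+1..N} (\<lambda>_. M). Q (merge {1..k} {k+1..N} (x, y))"
proof -
  interpret pair_sigma_finite "L k" "PiM {k+1..N} (\<lambda>_. M)"
    by (intro pair_sigma_finite.intro sigma_finite) simp_all
  have un: "{1..k} \<union> {k+1..N} = {1..N}" using k by auto
  have d: "distr (L k \<Otimes>\<^sub>M PiM {k+1..N} (\<lambda>_. M)) (L N) (merge {1..k} {k+1..N}) = L N"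
    using distr_merge[of "{1..k}" "{k+1..N}"] by (simp add: un)
  have m: "merge {1..k} {k+1..N} \<in> measurable (L k \<Otimes>\<^sub>M PiM {k+1..N} (\<lambda>_. M)) (L N)"
    using measurable_merge[of "{1..k}" "{k+1..N}" "\<lambda>_. M"] by (simp add: un)
  have "AE z in L k \<Otimes>\<^sub>M PiM {k+1..N} (\<lambda>_. M). Q (merge {1..k} {k+1..N} z)"
    by (rule AE_distrD[OF m]) (simp only: d Q)
  then show ?thesis by (rule AE_pair)
qed

lemma nn_integral_marginal:
  assumes k: "k \<le> N" and p: "p \<in> borel_measurable (L N)"
  shows "(\<integral>\<^sup>+x. marginal N k p x \<partial>L k) = (\<integral>\<^sup>+x. p x \<partial>L N)"
proof -
  have un: "{1..k} \<union> {k+1..N} = {1..N}" using k by auto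
  show ?thesis
    unfolding marginal_def using product_nn_integral_fold[of "{1..k}" "{k+1..N}" p] p by (simp add: un)
qed

text \<open>The Bochner integral in \<open>reduction\<close> is 0 where the integrand is not
  integrable, which could break the equality. Finite total mass makes the marginal finite almost
  everywhere and excludes this.\<close>

lemma reduction_AE:
  assumes k: "k \<le> N" and P' [measurable]: "P' \<in> borel_measurable (L N)"
    and PP': "AE x in L N. P x = P' x" and nonneg: "AE x in L N. 0 \<le> P x"
    and fin: "(\<integral>\<^sup>+x. ennreal (P' x) \<partial>L N) < \<infinity>"
  shows "AE x in L k. ennreal (reduction M N k P x) = marginal N k (\<lambda>x. ennreal (P' x)) x"
proof (cases "k = N")
  case True
  show ?thesis
    using PP' AE_space unfolding True by eventually_elim (simp add: reduction_def marginal_self)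
next
  case False
  let ?J = "PiM {k+1..N} (\<lambda>_. M)" and ?m = "\<lambda>x y. merge {1..k} {k+1..N} (x, y)"
  define p where "p = (\<lambda>x. ennreal (P' x))"
  have p: "p \<in> borel_measurable (L N)" unfolding p_def by measurable
  have "AE z in L N. P z = P' z \<and> 0 \<le> P' z"
    using PP' nonneg by eventually_elim simp
  note eq = AE_merge[OF k this]
  have "AE x in L k. marginal N k p x \<noteq> \<infinity>"
    by (rule nn_integral_PInf_AE[OF measurable_marginal[OF k p]])
      (use fin nn_integral_marginal[OF k p] in \<open>simp add: p_def\<close>)
  then have "AE x in L k. ennreal (reduction M N k P x) = marginal N k p x"
    using AE_space eq
  proof eventually_elim
    case (elim x)
    have [measurable]: "(\<lambda>y. P' (?m x y)) \<in> borel_measurable ?J"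
      using measurable_Pair2[OF measurable_merge_L[OF k P'] elim(2)] by simp
    have PP: "AE y in ?J. P (?m x y) = P' (?m x y)" and nn: "AE y in ?J. 0 \<le> P' (?m x y)"
      using elim(3) by auto
    have marginal: "marginal N k p x = (\<integral>\<^sup>+y. ennreal (P' (?m x y)) \<partial>?J)"
      by (simp add: marginal_def p_def)
    have int: "integrable ?J (\<lambda>y. P' (?m x y))"
      using elim(1) by (intro integrableI_nonneg nn) (simp_all add: marginal top.not_eq_extremum)
    have "reduction M N k P x = (\<integral>y. P (?m x y) \<partial>completion ?J)"
      using False by (simp add: reduction_def power_measure_def)
    also have "\<dots> = (\<integral>y. P' (?m x y) \<partial>completion ?J)"
      by (intro integral_cong_AE borel_measurable_completion_AE[OF _ PP] measurable_completion AE_completion PP)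
        measurable
    also have "\<dots> = (\<integral>y. P' (?m x y) \<partial>?J)"
      by (rule integral_completion) measurable
    finally show ?case
      unfolding marginal nn_integral_eq_integral[OF int nn] by simp
  qed
  then show ?thesis by (simp only: p_def)
qed

text \<open>The measure depends on \<open>w\<close> only through \<open>ennreal (w x)\<close> up to
  null sets, so \<open>q\<close> is an equivalent density. The norm formula covers infinite
  integrals too: there the Bochner integral and \<open>enn2real\<close> both give 0.\<close>

lemma
  assumes q: "q \<in> borel_measurable (L k)" and w: "AE x in L k. ennreal (w x) = q x"
  shows in_Lr_weighted: "in_Lr r (weighted_measure M k w) f
      \<longleftrightarrow> f \<in> borel_measurable (Lc k) \<and> wint r q k f < \<infinity>"
    and norm_Lr_weighted: "f \<in> borel_measurable (Lc k) \<Longrightarrow>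
      norm_Lr r (weighted_measure M k w) f = enn2real (wint r q k f) powr (1 / r)"
proof -
  have qc [measurable]: "q \<in> borel_measurable (Lc k)" by (rule measurable_completion[OF q])
  have wc [measurable]: "(\<lambda>x. ennreal (w x)) \<in> borel_measurable (Lc k)"
    by (rule borel_measurable_completion_AE[OF q w])
  have \<mu>: "weighted_measure M k w = density (Lc k) q"
    unfolding weighted_measure_def power_measure_eq
    by (rule density_cong[OF wc qc AE_completion[OF w]])
  have nn: "(\<integral>\<^sup>+x. ennreal (\<bar>f x\<bar> powr r) \<partial>weighted_measure M k w) = wint r q k f"
    if [measurable]: "f \<in> borel_measurable (Lc k)" for f :: "(nat \<Rightarrow> 'a) \<Rightarrow> real"
    unfolding \<mu> wint_def
    by (subst nn_integral_density) (auto simp: nn_integral_completion mult.commute)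
  have meas: "borel_measurable (weighted_measure M k w) = (borel_measurable (Lc k) :: ((nat \<Rightarrow> 'a) \<Rightarrow> real) set)"
    unfolding \<mu> by (rule measurable_cong_sets) simp_all
  show "in_Lr r (weighted_measure M k w) f
      \<longleftrightarrow> f \<in> borel_measurable (Lc k) \<and> wint r q k f < \<infinity>"
    unfolding in_Lr_def meas integrable_iff_bounded using nn[of f] by auto
  show "norm_Lr r (weighted_measure M k w) f = enn2real (wint r q k f) powr (1 / r)"
    if f: "f \<in> borel_measurable (Lc k)"
  proof -
    have "(\<lambda>x. \<bar>f x\<bar> powr r) \<in> borel_measurable (weighted_measure M k w)"
      unfolding meas using f by measurable
    then show ?thesis
      unfolding norm_Lr_def using nn[OF f] by (simp add: integral_eq_nn_integral)
  qed
qed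

text \<open>Passage to r-th roots. Finiteness of \<open>Y\<close> matters because
  \<open>enn2real\<close> sends infinity to 0.\<close>

lemma norm_bound:
  assumes r: "1 \<le> r" and A: "0 \<le> A" and le: "X \<le> ennreal (A powr r) * Y" and fin: "Y < \<infinity>"
  shows "enn2real X powr (1 / r) \<le> A * enn2real Y powr (1 / r)"
proof -
  have "enn2real X \<le> enn2real (ennreal (A powr r) * Y)"
    using fin by (intro enn2real_mono[OF le]) (auto simp: ennreal_mult_less_top)
  also have "\<dots> = A powr r * enn2real Y" by (simp add: enn2real_mult)
  finally have "enn2real X powr (1 / r) \<le> (A powr r * enn2real Y) powr (1 / r)"
    using r by (intro powr_mono2) auto
  also have "\<dots> = A * enn2real Y powr (1 / r)"
    using r A by (simp add: powr_mult powr_powr)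
  finally show ?thesis .
qed

lemma nonnull_of_pos:
  assumes "B \<in> sets M" "emeasure M B > 0"
  shows "nonnull B"
  using assms null_sets_subset[of _ M B] sets.sets_into_space[of B M]
  by (auto simp: nonnull_def null_sets_def)

text \<open>If for every \<open>n\<close> the values \<open>t\<close> admitting the constant
  \<open>n\<close> lay in a null set, the countable union of these sets would contain almost all of
  \<open>B\<close>. This yields one constant although it may depend on \<open>t\<close> in a
  nonmeasurable way.\<close>

lemma slices_dominateI:
  assumes "nonnull B"
    and "AE t in M. t \<in> B \<longrightarrow> (\<exists>n::nat. AE x in L k. integrate_last k p x \<le> ennreal (real n) * p (x(Suc k := t)))"
  shows "slices_dominate k p"
proof -
  define Q where "Q n t \<longleftrightarrow> (AE x in L k. integrate_last k p x \<le> ennreal (real n) * p (x(Suc k := t)))" for n t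
  have "\<exists>n. nonnull {t \<in> B. Q n t}"
  proof (rule ccontr)
    assume "\<not> ?thesis"
    moreover have "{t \<in> B. Q n t} \<subseteq> space M" for n
      using assms(1) by (auto simp: nonnull_def)
    ultimately have "\<exists>S. S \<in> null_sets M \<and> {t \<in> B. Q n t} \<subseteq> S" for n
      unfolding nonnull_def by blast
    then obtain S where S: "\<And>n. S n \<in> null_sets M" "\<And>n. {t \<in> B. Q n t} \<subseteq> S n" by metis
    have "{t \<in> B. t \<in> B \<longrightarrow> (\<exists>n. Q n t)} \<subseteq> (\<Union>n. S n)" using S(2) by blast
    moreover have "(\<Union>n. S n) \<in> null_sets M" using S(1) by (rule null_sets_UN)
    ultimately show False using nonnull_AE[OF assms(1) assms(2)[folded Q_def]] by (auto simp: nonnull_def)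
  qed
  then obtain n where "nonnull {t \<in> B. Q n t}" ..
  then show ?thesis
    unfolding slices_dominate_def Q_def by (intro exI[of _ "{t \<in> B. Q n t}"] exI[of _ "real n"]) (auto simp: Q_def)
qed

lemma admissible_of_density:
  assumes N: "N \<ge> 1" and P' [measurable]: "P' \<in> borel_measurable (L N)"
    and PP': "AE x in L N. P x = P' x" and nonneg: "AE x in L N. 0 \<le> P x"
    and fin: "(\<integral>\<^sup>+x. ennreal (P' x) \<partial>L N) < \<infinity>"
    and sym: "symmetric_on M N P"
    and dom: "N \<ge> 2 \<Longrightarrow>
      \<exists>B\<in>sets M. emeasure M B > 0 \<and>
        (AE t in M. t \<in> B \<longrightarrow>
          (\<exists>\<gamma>>0. AE x in power_measure M {1..N-1}.
             P (x(N := t)) \<ge> \<gamma> * reduction M N (N-1) P x))"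
  shows "admissible N (\<lambda>x. ennreal (P' x))"
  unfolding admissible_def
proof (intro conjI allI impI)
  show "(\<lambda>x. ennreal (P' x)) \<in> borel_measurable (L N)" by measurable
  show "symmetric_weight N (\<lambda>x. ennreal (P' x))"
    unfolding symmetric_weight_def
  proof (intro allI impI)
    fix \<pi> assume \<pi>: "\<pi> permutes {1..N}"
    then have "AE x in L N. P (x \<circ> \<pi>) = P x"
      using sym by (simp only: symmetric_on_def power_measure_eq AE_completion_iff)
    then show "AE x in L N. ennreal (P' (x \<circ> \<pi>)) = ennreal (P' x)"
      using PP' AE_perm[OF \<pi> PP'] by eventually_elim simp
  qed
next
  fix k assume k: "1 \<le> k" and Nk: "N = Suc k"
  let ?p = "\<lambda>x. ennreal (P' x)"
  obtain B where B: "B \<in> sets M" "emeasure M B > 0" and AE_B: "AE t in M. t \<in> B \<longrightarrow>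
      (\<exists>\<gamma>>0. AE x in L k. P (x(Suc k := t)) \<ge> \<gamma> * reduction M N k P x)"
    using dom k unfolding Nk diff_Suc_1 power_measure_eq AE_completion_iff by auto
  have kN: "k \<le> N" by (simp add: Nk)
  \<comment> \<open>From \<open>N\<close> to \<open>N - 1\<close> variables only one is removed, so
    the reduction is a single \<open>integrate_last\<close>.\<close>
  have red: "AE x in L k. ennreal (reduction M N k P x) = integrate_last k ?p x"
    using reduction_AE[OF kN P' PP' nonneg fin] AE_space
  proof eventually_elim
    case (elim x)
    have "marginal (Suc k) k ?p x = marginal k k (integrate_last k ?p) x"
      by (rule marginal_Suc) (use P' elim Nk in simp_all)
    then show ?case using elim by (simp add: marginal_self Nk)
  qed
  have "AE t in M. AE x in L k. P (x(Suc k := t)) = P' (x(Suc k := t))"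
    using PP' unfolding Nk by (rule AE_Suc_rev)
  then have "AE t in M. t \<in> B \<longrightarrow> (\<exists>n::nat. AE x in L k. integrate_last k ?p x \<le> ennreal (real n) * ?p (x(Suc k := t)))"
    using AE_B
  proof eventually_elim
    case (elim t)
    show ?case
    proof
      assume "t \<in> B"
      then obtain \<gamma> where \<gamma>: "\<gamma> > 0" "AE x in L k. P (x(Suc k := t)) \<ge> \<gamma> * reduction M N k P x"
        using elim by auto
      \<comment> \<open>An integer above \<open>1 / \<gamma>\<close> leaves only countably many
        constants, as \<open>slices_dominateI\<close> requires.\<close>
      obtain n where n: "1 / \<gamma> \<le> real n" using real_arch_simple by blast
      have "AE x in L k. integrate_last k ?p x \<le> ennreal (real n) * ?p (x(Suc k := t))"
        using red elim(1) \<gamma>(2)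
      proof eventually_elim
        case (elim x)
        have "reduction M N k P x \<le> 1 / \<gamma> * P' (x(Suc k := t))"
          using elim(2,3) \<gamma>(1) by (simp add: field_simps)
        then have "integrate_last k ?p x \<le> ennreal (1 / \<gamma>) * ?p (x(Suc k := t))"
          unfolding elim(1)[symmetric] using \<gamma>(1)
          by (subst ennreal_mult'[symmetric]) (auto intro: ennreal_leI)
        also have "\<dots> \<le> ennreal (real n) * ?p (x(Suc k := t))"
          using n by (intro mult_right_mono ennreal_leI) auto
        finally show ?case .
      qed
      then show "\<exists>n::nat. AE x in L k. integrate_last k ?p x \<le> ennreal (real n) * ?p (x(Suc k := t))" ..
    qed
  qed
  then show "slices_dominate k ?p" by (rule slices_dominateI[OF nonnull_of_pos[OF B]])
qed

end

section \<open>Both norm bounds for a symmetric density\<close>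

theorem theorem12:
  fixes M :: "'a measure" and N m :: nat and P :: "(nat \<Rightarrow> 'a) \<Rightarrow> real"
  assumes "sigma_finite_measure M" and "complete_measure M" and "emeasure M (space M) > 0"
    and "N \<ge> 1"
    and "prob_density_on M N P" and "symmetric_on M N P"
    and "AE x in power_measure M {1..N}. P x > 0"
    and "N \<ge> 2 \<Longrightarrow>
      \<exists>B\<in>sets M. emeasure M B > 0 \<and>
        (AE t in M. t \<in> B \<longrightarrow>
          (\<exists>\<gamma>>0. AE x in power_measure M {1..N-1}.
             P (x(N := t)) \<ge> \<gamma> * reduction M N (N-1) P x))"
    and "1 \<le> m" and "m \<le> N"
  shows "(\<forall>r\<ge>1. \<forall>u. in_Lr r (weighted_measure M m (reduction M N m P)) u \<longrightarrow>
            in_Lr r (weighted_measure M N P) (gen_mean m N u) \<and>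
            norm_Lr r (weighted_measure M N P) (gen_mean m N u)
              \<le> norm_Lr r (weighted_measure M m (reduction M N m P)) u)
       \<and> (\<exists>C. \<forall>r\<ge>1. \<forall>U. in_Lr r (weighted_measure M N P) U \<and> is_gen_mean M m N U \<longrightarrow>
            in_Lr r (weighted_measure M m (reduction M N m P)) (gen_kernel M m N U) \<and>
            norm_Lr r (weighted_measure M m (reduction M N m P)) (gen_kernel M m N U)
              \<le> C * norm_Lr r (weighted_measure M N P) U)"
proof -
  interpret power_space M by (rule power_space.intro) fact
  have intP: "integrable (Lc N) P" and nonnegP: "AE x in L N. 0 \<le> P x" and int1: "(\<integral>x. P x \<partial>Lc N) = 1"
    using assms(5) unfolding prob_density_on_def power_measure_eq AE_completion_iff by auto
  obtain P' where P' [measurable]: "P' \<in> borel_measurable (L N)" and PP': "AE x in L N. P x = P' x"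
    using borel_representative[of P N] intP by blast
  define p where "p = (\<lambda>x. ennreal (P' x))"
  have "(\<integral>\<^sup>+x. p x \<partial>L N) = (\<integral>\<^sup>+x. ennreal (P x) \<partial>L N)"
    unfolding p_def using PP' by (intro nn_integral_cong_AE) (auto elim: eventually_mono)
  also have "\<dots> = (\<integral>\<^sup>+x. ennreal (P x) \<partial>Lc N)" by (simp only: nn_integral_completion)
  also have "\<dots> = ennreal 1"
    unfolding int1[symmetric] using nonnegP
    by (intro nn_integral_eq_integral[OF intP]) (simp add: AE_completion_iff)
  finally have fin: "(\<integral>\<^sup>+x. ennreal (P' x) \<partial>L N) < \<infinity>" by (simp add: p_def)
  have good: "admissible N p"
    unfolding p_def by (rule admissible_of_density[OF assms(4) P' PP' nonnegP fin assms(6,8)])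
  have p: "p \<in> borel_measurable (L N)" and sym: "symmetric_weight N p"
    using good by (auto simp: admissible_def)
  define q where "q = marginal N m p"
  have q: "q \<in> borel_measurable (L m)"
    unfolding q_def by (rule measurable_marginal[OF assms(10) p])
  have w_m: "AE x in L m. ennreal (reduction M N m P x) = q x"
    unfolding q_def p_def by (rule reduction_AE[OF assms(10) P' PP' nonnegP fin])
  have w_N: "AE x in L N. ennreal (P x) = p x"
    using PP' unfolding p_def by eventually_elim simp
  note Lr = in_Lr_weighted[OF q w_m] in_Lr_weighted[OF p w_N]
  note norm = norm_Lr_weighted[OF q w_m] norm_Lr_weighted[OF p w_N]
  define c where "c = real (N choose m)"
  have c: "c > 0" using assms(10) by (simp add: c_def)
  have gen: "gen_mean m N u = (\<lambda>x. 1 / c * kernel_sum m N u x)" for u :: "(nat \<Rightarrow> 'a) \<Rightarrow> real"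
    by (simp add: fun_eq_iff gen_mean_def kernel_sum_def c_def)
  show ?thesis
  proof (intro conjI allI impI)
    fix r :: real and u :: "(nat \<Rightarrow> 'a) \<Rightarrow> real"
    assume r: "1 \<le> r" and "in_Lr r (weighted_measure M m (reduction M N m P)) u"
    then have u: "u \<in> borel_measurable (Lc m)" and fin_u: "wint r q m u < \<infinity>"
      by (auto simp: Lr)
    note K = kernel_sum_bound[OF assms(10) u r p sym, folded q_def c_def]
    have G: "gen_mean m N u \<in> borel_measurable (Lc N)"
      unfolding gen using conjunct1[OF K] by measurable
    have "wint r p N (gen_mean m N u) \<le> ennreal ((1 / c) powr r) * wint r p N (kernel_sum m N u)"
      using c unfolding gen wint_scale[OF conjunct1[OF K] p] by simp
    \<comment> \<open>The normalization cancels the binomial constant of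
      \<open>kernel_sum_bound\<close>, so the final constant is 1.\<close>
    then have "wint r p N (gen_mean m N u) \<le> ennreal ((1 / c * c) powr r) * wint r q m u"
      by (rule ennreal_powr_chain) (use K c in auto)
    then have le: "wint r p N (gen_mean m N u) \<le> ennreal (1 powr r) * wint r q m u"
      using c by simp
    then have "wint r p N (gen_mean m N u) < \<infinity>" using fin_u by (auto intro: le_less_trans)
    then show "in_Lr r (weighted_measure M N P) (gen_mean m N u)" using G by (simp add: Lr)
    show "norm_Lr r (weighted_measure M N P) (gen_mean m N u)
        \<le> norm_Lr r (weighted_measure M m (reduction M N m P)) u"
      using norm_bound[OF r _ le fin_u] by (simp add: norm G u)
  next
    obtain C where C: "0 \<le> C" and bound: "\<And>r u. 1 \<le> r \<Longrightarrow> kernel_sum m N u \<in> borel_measurable (Lc N) \<Longrightarrow>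
      wint r p N (kernel_sum m N u) < \<infinity> \<Longrightarrow> u \<in> borel_measurable (Lc m) \<and>
      wint r q m u \<le> ennreal (C powr r) * wint r p N (kernel_sum m N u)"
      using kernel_bound[OF assms(10) good] unfolding q_def by blast
    show "\<exists>C. \<forall>r\<ge>1. \<forall>U. in_Lr r (weighted_measure M N P) U \<and> is_gen_mean M m N U \<longrightarrow>
            in_Lr r (weighted_measure M m (reduction M N m P)) (gen_kernel M m N U) \<and>
            norm_Lr r (weighted_measure M m (reduction M N m P)) (gen_kernel M m N U)
              \<le> C * norm_Lr r (weighted_measure M N P) U"
    \<comment> \<open>\<open>C\<close> bounds the kernel by its unnormalized sum, and that sum is
      \<open>c\<close> times \<open>U\<close>.\<close>
    proof (intro exI[of _ "C * c"] allI impI)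
      fix r :: real and U :: "(nat \<Rightarrow> 'a) \<Rightarrow> real"
      assume r: "1 \<le> r" and *: "in_Lr r (weighted_measure M N P) U \<and> is_gen_mean M m N U"
      then have U: "U \<in> borel_measurable (Lc N)" and fin_U: "wint r p N U < \<infinity>"
        by (auto simp: Lr)
      \<comment> \<open>The estimate holds for every kernel of \<open>U\<close>, hence for the
        representative picked by \<open>gen_kernel\<close>.\<close>
      define u where "u = gen_kernel M m N U"
      have "is_kernel_of M m N U u"
        using * someI_ex[of "is_kernel_of M m N U"] by (simp add: u_def gen_kernel_def is_gen_mean_def)
      then have "AE x in L N. U x = gen_mean m N u x"
        by (simp only: is_kernel_of_def power_measure_eq AE_completion_iff)
      then have K: "AE x in L N. kernel_sum m N u x = c * U x"
        by (rule eventually_mono) (use c in \<open>simp add: gen field_simps\<close>)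
      obtain g where [measurable]: "g \<in> borel_measurable (L N)" and g: "AE x in L N. U x = g x"
        using borel_representative[OF U] .
      have "AE x in L N. kernel_sum m N u x = c * g x" using K g by eventually_elim simp
      then have Km: "kernel_sum m N u \<in> borel_measurable (Lc N)"
        by (rule borel_measurable_completion_AE[rotated]) measurable
      have Kb: "wint r p N (kernel_sum m N u) = ennreal (c powr r) * wint r p N U"
        using c by (simp add: wint_cong_AE[OF K] wint_scale[OF U p])
      have "wint r p N (kernel_sum m N u) < \<infinity>"
        using fin_U unfolding Kb by (simp add: ennreal_mult_less_top)
      note u = bound[OF r Km this]
      have le: "wint r q m u \<le> ennreal ((C * c) powr r) * wint r p N U"
        using conjunct2[OF u]
        by (rule ennreal_powr_chain) (simp_all only: Kb order_refl C less_imp_le[OF c])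
      have "wint r q m u < \<infinity>"
        by (rule le_less_trans[OF le]) (use fin_U in \<open>simp add: ennreal_mult_less_top\<close>)
      with u have "in_Lr r (weighted_measure M m (reduction M N m P)) u" by (simp add: Lr)
      moreover have "norm_Lr r (weighted_measure M m (reduction M N m P)) u
          \<le> C * c * norm_Lr r (weighted_measure M N P) U"
        using norm_bound[OF r _ le fin_U] C c by (simp add: norm U conjunct1[OF u])
      ultimately show "in_Lr r (weighted_measure M m (reduction M N m P)) (gen_kernel M m N U) \<and>
            norm_Lr r (weighted_measure M m (reduction M N m P)) (gen_kernel M m N U)
              \<le> C * c * norm_Lr r (weighted_measure M N P) U"
        unfolding u_def by blast
    qed
  qed
qed

end
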